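(* Let $P$ be a finite set of $n\ge 3$ points in general position in the plane, and let $\Pi$ be a convex decomposition of $P$ consisting of more than one polygon. Then $\Pi$ contains a deletable edge or $\Pi$ contains a contractible edge (the "or" being inclusive).
   Context: Points are in general position if no three are collinear. $CH(P)$ denotes the convex hull of $P$. A convex decomposition of $P$ is a set $\Pi$ of convex polygons with vertices in $P$ and pairwise disjoint interiors such that their union is $CH(P)$ and no point of $P$ lies in the interior of any polygon of $\Pi$. The skeleton graph $G(\Pi)$ is the plane geometric (straight-line) graph with vertex set $P$ whose edges are the sides of all polygons in $\Pi$; edges of $G(\Pi)$ are also called edges of $\Pi$. An edge $e$ of $\Pi$ is an interior edge if it is not an edge of the boundary of $CH(P)$. An interior edge $e$ of $\Pi$ is deletable if the geometric graph $G(\Pi)-e$ (same vertex set $P$, with $e$ removed) is the skeleton graph of a convex decomposition of $P$. An interior edge $uv$ of $\Pi$ is contractible from $u$ to $v$ if, $x_1,\dots,x_m$ being the vertices other than $v$ that are adjacent to $u$ in $G(\Pi)$, the geometric graph with vertex set $P\setminus\{u\}$ $$G(\Pi)/\overrightarrow{uv}=(G(\Pi)-\{x_1u,\dots,x_mu,uv\})+\{x_1v,\dots,x_mv\}$$ (a simple graph, with straight-line edges) is the skeleton graph of a convex decomposition of $P\setminus\{u\}$. An edge is contractible if it is contractible from one of its ends to the other. *)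

theory Defs
  imports "HOL-Analysis.Analysis"
begin

type_synonym point = "real^2"

definition general_position :: "point set \<Rightarrow> bool" where
  "general_position P \<longleftrightarrow>
     (\<forall>a\<in>P. \<forall>b\<in>P. \<forall>c\<in>P. a \<noteq> b \<and> a \<noteq> c \<and> b \<noteq> c \<longrightarrow> \<not> collinear {a, b, c})"

text \<open>Polygons are filled and nondegenerate.\<close>

definition convex_polygon :: "point set \<Rightarrow> bool" where
  "convex_polygon A \<longleftrightarrow> polytope A \<and> interior A \<noteq> {}"

definition polygon_vertices :: "point set \<Rightarrow> point set" where
  "polygon_vertices A = {x. x extreme_point_of A}"

definition convex_decomposition :: "point set \<Rightarrow> point set set \<Rightarrow> bool" where
  "convex_decomposition P D \<longleftrightarrow>
     (\<forall>A\<in>D. convex_polygon A \<and> polygon_vertices A \<subseteq> P) \<and>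
     pairwise (\<lambda>A B. interior A \<inter> interior B = {}) D \<and>
     \<Union>D = convex hull P \<and>
     (\<forall>A\<in>D. P \<inter> interior A = {})"

text \<open>
  A straight-line geometric graph is a pair of a vertex set and a set of edges, where an edge
  is the two-element set of its endpoints; the drawing is determined by these data.
\<close>

type_synonym geometric_graph = "point set \<times> point set set"

text \<open>A side of a polygon is a one-dimensional face, so the two points below are distinct.\<close>

definition polygon_sides :: "point set \<Rightarrow> point set set" where
  "polygon_sides A = {{a, b} | a b. closed_segment a b edge_of A}"

definition skeleton_edges :: "point set set \<Rightarrow> point set set" where
  "skeleton_edges D = (\<Union>A\<in>D. polygon_sides A)"

definition skeleton_graph :: "point set \<Rightarrow> point set set \<Rightarrow> geometric_graph" where
  "skeleton_graph P D = (P, skeleton_edges D)"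

definition is_skeleton_of_decomposition :: "point set \<Rightarrow> geometric_graph \<Rightarrow> bool" where
  "is_skeleton_of_decomposition P G \<longleftrightarrow>
     (\<exists>D. convex_decomposition P D \<and> G = skeleton_graph P D)"

definition interior_edge :: "point set \<Rightarrow> point set set \<Rightarrow> point set \<Rightarrow> bool" where
  "interior_edge P D e \<longleftrightarrow> e \<in> skeleton_edges D \<and> e \<notin> polygon_sides (convex hull P)"

definition delete_edge :: "geometric_graph \<Rightarrow> point set \<Rightarrow> geometric_graph" where
  "delete_edge G e = (fst G, snd G - {e})"

definition deletable :: "point set \<Rightarrow> point set set \<Rightarrow> point set \<Rightarrow> bool" where
  "deletable P D e \<longleftrightarrow>
     interior_edge P D e \<and>
     is_skeleton_of_decomposition P (delete_edge (skeleton_graph P D) e)"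

text \<open>
  Contraction moves \<open>u\<close> onto \<open>v\<close>. Since edges form a set, an edge \<open>{x, v}\<close> that is already
  present is not duplicated.
\<close>

definition contract_edge :: "geometric_graph \<Rightarrow> point \<Rightarrow> point \<Rightarrow> geometric_graph" where
  "contract_edge G u v =
     (let X = {x. x \<noteq> v \<and> {x, u} \<in> snd G}
      in (fst G - {u}, (snd G - ({{x, u} | x. x \<in> X} \<union> {{u, v}})) \<union> {{x, v} | x. x \<in> X}))"

definition contractible_from_to :: "point set \<Rightarrow> point set set \<Rightarrow> point \<Rightarrow> point \<Rightarrow> bool" where
  "contractible_from_to P D u v \<longleftrightarrow>
     interior_edge P D {u, v} \<and>
     is_skeleton_of_decomposition (P - {u}) (contract_edge (skeleton_graph P D) u v)"

definition contractible_edge :: "point set \<Rightarrow> point set set \<Rightarrow> point set \<Rightarrow> bool" where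
  "contractible_edge P D e \<longleftrightarrow> (\<exists>u v. e = {u, v} \<and> contractible_from_to P D u v)"

end

theory Submission
  imports Defs
begin

text \<open>
  In general position, the skeletons of convex decompositions are exactly the crossing-free graphs
  that contain the hull sides and in which every vertex \<open>v\<close> inside the hull lies in the interior of
  the convex hull of its neighbours: the latter makes the components of the complement convex. Hence
  an interior edge \<open>uv\<close> is deletable unless it is needed at one of its ends \<open>v\<close>, that is, \<open>v\<close> leaves
  the hull of its neighbours when \<open>uv\<close> is removed. At most two edges are needed at an inner vertex
  of degree at least four, and all three at one of degree three.

  An inner vertex \<open>u\<close> of degree three can be contracted to its neighbour \<open>c\<close> unless for another
  neighbour \<open>a\<close> the condition at \<open>a\<close> fails after replacing \<open>u\<close> by \<open>c\<close>; then \<open>ua\<close> is needed at both ends.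
  If nothing is contractible, each such \<open>u\<close> has at least three obstructions of this kind,
  while an edge carries at most two. Weighting the directed edge \<open>uv\<close> by \<open>2[needed at u] - 1 - #obstructions\<close>,
  every interior edge gets a nonnegative total if nothing is deletable, every inner vertex
  a nonpositive one, and every hull vertex minus its number of interior edges. As some interior edge
  ends at a hull vertex, this is a contradiction.
\<close>

section \<open>Orientation of point triples\<close>

text \<open>The constants of the weighting make every critical case tight. At a vertex it sums to
  twice the number of needed edges minus the degree minus the number of obstructions: at most
  \<open>2*2 - 4\<close> from degree four on and \<open>2*3 - 3 - 3\<close> in degree three. An edge
  without obstructions has at least \<open>2 - 2\<close>; one with obstructions is needed at both
  ends and has at least \<open>4 - 2 - 2\<close>. The three obstructions at \<open>u\<close> of
  degree three stem from the three possible targets, each blocked by one of the other two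
  neighbours. The bound of two per edge is delicate only if both ends have degree three: the
  remaining neighbours of the ends are then paired across the line through the edge, and each pair
  admits at most one obstruction. Contraction could also create a crossing. This never happens,
  because a triangle spanned by \<open>u\<close> and two of its three neighbours has no vertex in
  its interior. Here and elsewhere the lever is the same: a surrounded vertex has a neighbour
  strictly farther in every direction, so a vertex that is extremal in a suitable set cannot exist
  or must have an edge leaving that set.\<close>

text \<open>Twice the signed area of the triangle \<open>a b c\<close>; its sign tells on which side
  of the line \<open>a b\<close> the point \<open>c\<close> lies. Being a polynomial in the
  coordinates, it reduces plane geometry to ring identities and sign arguments.\<close>

definition orient :: "point \<Rightarrow> point \<Rightarrow> point \<Rightarrow> real" where
  "orient a b c = (b$1 - a$1) * (c$2 - a$2) - (b$2 - a$2) * (c$1 - a$1)"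

lemma point_eq_iff: "(x::point) = y \<longleftrightarrow> x$1 = y$1 \<and> x$2 = y$2"
  by (simp add: vec_eq_iff forall_2)

lemma orient_zero_param:
  assumes "orient a b c = 0" "a \<noteq> b"
  obtains k where "c = (1 - k) *\<^sub>R a + k *\<^sub>R b"
proof -
  have "\<exists>k. c$1 - a$1 = k * (b$1 - a$1) \<and> c$2 - a$2 = k * (b$2 - a$2)"
  proof (cases "b$1 = a$1")
    case True
    with assms(2) have "b$2 \<noteq> a$2" by (auto simp: point_eq_iff)
    with True assms(1) show ?thesis
      by (intro exI[of _ "(c$2 - a$2) / (b$2 - a$2)"]) (simp add: orient_def)
  next
    case False
    with assms(1) show ?thesis
      by (intro exI[of _ "(c$1 - a$1) / (b$1 - a$1)"]) (simp add: orient_def field_simps)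
  qed
  then obtain k where "c$1 - a$1 = k * (b$1 - a$1)" "c$2 - a$2 = k * (b$2 - a$2)" by blast
  then show thesis by (intro that[of k]) (simp add: point_eq_iff algebra_simps)
qed

lemma collinear_iff_orient: "collinear {a, b, c} \<longleftrightarrow> orient a b c = 0"
proof (cases "b = a")
  case True
  then show ?thesis by (simp add: orient_def)
next
  case False
  have "collinear {a, b, c} \<longleftrightarrow> collinear {b, a, c}" by (simp add: insert_commute)
  also have "\<dots> \<longleftrightarrow> collinear {0, b - a, c - a}" by (rule collinear_3) simp
  also have "\<dots> \<longleftrightarrow> (\<exists>k. c - a = k *\<^sub>R (b - a))"
    using False by (auto simp: collinear_lemma intro: exI[of _ 0])
  also have "\<dots> \<longleftrightarrow> orient a b c = 0"
  proof
    assume "\<exists>k. c - a = k *\<^sub>R (b - a)"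
    then obtain k where "c - a = k *\<^sub>R (b - a)" by blast
    then show "orient a b c = 0" by (simp add: point_eq_iff orient_def)
  next
    assume "orient a b c = 0"
    then obtain k where "c = (1 - k) *\<^sub>R a + k *\<^sub>R b" using orient_zero_param False by metis
    then have "c - a = k *\<^sub>R (b - a)" by (simp add: algebra_simps)
    then show "\<exists>k. c - a = k *\<^sub>R (b - a)" by blast
  qed
  finally show ?thesis .
qed

lemma orient_rotate: "orient b c a = orient a b c"
  by (simp add: orient_def algebra_simps)

lemma orient_swap: "orient b a c = - orient a b c"
  by (simp add: orient_def algebra_simps)

lemma orient_refl [simp]: "orient a a b = 0" "orient a b a = 0" "orient a b b = 0"
  by (simp_all add: orient_def)

lemma orient_segment: "orient a b ((1 - t) *\<^sub>R x + t *\<^sub>R y) = (1 - t) * orient a b x + t * orient a b y"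
  by (simp add: orient_def algebra_simps)

lemma orient_combination:
  "u + v + w = 1 \<Longrightarrow>
   orient a b (u *\<^sub>R x + v *\<^sub>R y + w *\<^sub>R z) = u * orient a b x + v * orient a b y + w * orient a b z"
proof -
  assume "u + v + w = 1"
  then have u: "u = 1 - v - w" by simp
  show ?thesis unfolding u by (simp add: orient_def algebra_simps)
qed

text \<open>Cramer's rule: barycentric coordinates are ratios of signed areas.\<close>

lemma barycentric:
  assumes "orient a b c \<noteq> 0"
  shows "p = (orient b c p / orient a b c) *\<^sub>R a + (orient c a p / orient a b c) *\<^sub>R b
             + (orient a b p / orient a b c) *\<^sub>R c"
    and "orient b c p / orient a b c + orient c a p / orient a b c + orient a b p / orient a b c = 1"
proof -
  have "orient a b c * p$1 = orient b c p * a$1 + orient c a p * b$1 + orient a b p * c$1"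
       "orient a b c * p$2 = orient b c p * a$2 + orient c a p * b$2 + orient a b p * c$2"
    by (simp_all add: orient_def algebra_simps)
  with assms show "p = (orient b c p / orient a b c) *\<^sub>R a + (orient c a p / orient a b c) *\<^sub>R b
             + (orient a b p / orient a b c) *\<^sub>R c"
    by (simp add: point_eq_iff field_simps)
  have "orient b c p + orient c a p + orient a b p = orient a b c"
    by (simp add: orient_def algebra_simps)
  with assms show "orient b c p / orient a b c + orient c a p / orient a b c + orient a b p / orient a b c = 1"
    by (simp add: add_divide_distrib[symmetric])
qed

lemma interior_triangle_empty_iff: "interior (convex hull {a, b, c}) = {} \<longleftrightarrow> orient a b c = 0"
proof
  assume "orient a b c = 0"
  then have "collinear {a,b,c}" by (simp add: collinear_iff_orient)
  then have "aff_dim (convex hull {a,b,c}) < int DIM(point)"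
    by (simp add: collinear_aff_dim aff_dim_convex_hull)
  then show "interior (convex hull {a, b, c}) = {}" using aff_dim_nonempty_interior by force
next
  assume *: "interior (convex hull {a, b, c}) = {}"
  show "orient a b c = 0"
  proof (rule ccontr)
    assume "orient a b c \<noteq> 0"
    then have "\<not> collinear {a,b,c}" by (simp add: collinear_iff_orient)
    from interior_convex_hull_3_minimal[OF this]
    have "(1/3) *\<^sub>R a + (1/3) *\<^sub>R b + (1/3) *\<^sub>R c \<in> interior (convex hull {a,b,c})"
      by auto (rule exI[of _ "1/3"], simp, rule exI[of _ "1/3"], simp, rule exI[of _ "1/3"], simp)
    with * show False by simp
  qed
qed

text \<open>Barycentric coordinates must be positive. No orientation of \<open>a b c\<close> is
  fixed, and degenerate triangles are covered: the three areas add up to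
  \<open>orient a b c\<close>, so a common strict sign makes it nonzero.\<close>

lemma interior_triangle_iff:
  "p \<in> interior (convex hull {a, b, c}) \<longleftrightarrow>
     (orient a b p > 0 \<and> orient b c p > 0 \<and> orient c a p > 0) \<or>
     (orient a b p < 0 \<and> orient b c p < 0 \<and> orient c a p < 0)"
proof (cases "orient a b c = 0")
  case True
  have "orient b c p + orient c a p + orient a b p = orient a b c"
    by (simp add: orient_def algebra_simps)
  with True interior_triangle_empty_iff[of a b c] show ?thesis by force
next
  case False
  then have nc: "\<not> collinear {a,b,c}" by (simp add: collinear_iff_orient)
  have sum: "orient b c p + orient c a p + orient a b p = orient a b c"
    by (simp add: orient_def algebra_simps)
  show ?thesis
  proof
    assume "p \<in> interior (convex hull {a, b, c})"
    then obtain x y z where xyz: "0 < x" "0 < y" "0 < z" "x + y + z = 1"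
      and p: "p = x *\<^sub>R a + y *\<^sub>R b + z *\<^sub>R c"
      using interior_convex_hull_3_minimal[OF nc] by auto
    have "orient a b p = z * orient a b c" "orient b c p = x * orient a b c"
         "orient c a p = y * orient a b c"
      using orient_rotate[of b c a] orient_rotate[of c a b]
      unfolding p by (simp_all add: orient_combination[OF xyz(4)])
    with False xyz show "(orient a b p > 0 \<and> orient b c p > 0 \<and> orient c a p > 0) \<or>
     (orient a b p < 0 \<and> orient b c p < 0 \<and> orient c a p < 0)"
      by (cases "orient a b c > 0") (auto simp: mult_less_0_iff)
  next
    assume "(orient a b p > 0 \<and> orient b c p > 0 \<and> orient c a p > 0) \<or>
     (orient a b p < 0 \<and> orient b c p < 0 \<and> orient c a p < 0)"
    then have "0 < orient b c p / orient a b c \<and> 0 < orient c a p / orient a b c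
       \<and> 0 < orient a b p / orient a b c"
      using sum by (auto simp: zero_less_divide_iff)
    then show "p \<in> interior (convex hull {a, b, c})"
      unfolding interior_convex_hull_3_minimal[OF nc, simplified]
      using barycentric[OF False, of p] by (smt (verit) mem_Collect_eq)
  qed
qed

text \<open>Separation of a point from an open convex set. In this form a vertex that is not
  surrounded by its neighbours has all of them in a closed half-plane through it, and a surrounded
  one has a neighbour strictly beyond it in every direction.\<close>

lemma not_in_interior_convex_hull_iff:
  fixes S :: "'a::euclidean_space set"
  shows "v \<notin> interior (convex hull S) \<longleftrightarrow> (\<exists>w. w \<noteq> 0 \<and> (\<forall>x\<in>S. w \<bullet> (x - v) \<le> 0))"
proof
  assume v: "v \<notin> interior (convex hull S)"
  show "\<exists>w. w \<noteq> 0 \<and> (\<forall>x\<in>S. w \<bullet> (x - v) \<le> 0)"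
  proof (cases "interior (convex hull S) = {}")
    case True
    then obtain a b where ab: "a \<noteq> 0" "convex hull S \<subseteq> {x. a \<bullet> x = b}"
      using empty_interior_subset_hyperplane[OF convex_convex_hull] by blast
    have "S \<subseteq> {x. a \<bullet> x = b}" using ab(2) hull_subset[of S convex] by blast
    show ?thesis
    proof (cases "b - a \<bullet> v \<le> 0")
      case True
      then show ?thesis using ab(1) \<open>S \<subseteq> _\<close>
        by (intro exI[of _ a]) (auto simp: inner_diff_right)
    next
      case False
      then show ?thesis using ab(1) \<open>S \<subseteq> _\<close>
        by (intro exI[of _ "-a"]) (auto simp: inner_diff_right)
    qed
  next
    case False
    have "convex (interior (convex hull S))" by (intro convex_interior convex_convex_hull)
    then obtain a b where ab: "a \<noteq> 0" "\<forall>x\<in>{v}. a \<bullet> x \<le> b" "\<forall>x\<in>interior (convex hull S). a \<bullet> x \<ge> b"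
      using separating_hyperplane_sets[of "{v}" "interior (convex hull S)"] False v by auto
    \<comment> \<open>The separation is known only on the interior; it extends to \<open>S\<close>
      because a convex set with nonempty interior lies in the closure of that interior.\<close>
    have "closure (interior (convex hull S)) = closure (convex hull S)"
      by (rule convex_closure_interior[OF convex_convex_hull False])
    moreover have "closure (interior (convex hull S)) \<subseteq> {x. a \<bullet> x \<ge> b}"
      using ab(3) by (intro closure_minimal) (auto simp: closed_halfspace_ge)
    ultimately have "S \<subseteq> {x. a \<bullet> x \<ge> b}"
      using hull_subset[of S convex] closure_subset[of "convex hull S"] by blast
    then show ?thesis using ab(1,2)
      by (intro exI[of _ "-a"]) (force simp: inner_diff_right)
  qed
next
  assume "\<exists>w. w \<noteq> 0 \<and> (\<forall>x\<in>S. w \<bullet> (x - v) \<le> 0)"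
  then obtain w where w: "w \<noteq> 0" "\<forall>x\<in>S. w \<bullet> (x - v) \<le> 0" by blast
  have "convex hull S \<subseteq> {x. w \<bullet> x \<le> w \<bullet> v}"
    using w(2) by (intro hull_minimal) (auto simp: inner_diff_right convex_halfspace_le)
  then have "interior (convex hull S) \<subseteq> {x. w \<bullet> x < w \<bullet> v}"
    using interior_mono interior_halfspace_le[OF w(1)] by blast
  then show "v \<notin> interior (convex hull S)" by auto
qed

text \<open>The vector \<open>b - a\<close> turned by a right angle, which is the gradient of
  \<open>orient a b\<close>. It translates sides of a line into the linear functionals of the
  separation criterion.\<close>

definition normal :: "point \<Rightarrow> point \<Rightarrow> point" where
  "normal a b = vector [a$2 - b$2, b$1 - a$1]"

lemma normal_nonzero: "a \<noteq> b \<Longrightarrow> normal a b \<noteq> 0"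
  by (auto simp: normal_def point_eq_iff)

lemma orient_diff_inner: "orient a b x - orient a b y = normal a b \<bullet> (x - y)"
  by (simp add: orient_def normal_def inner_vec_def sum_2 algebra_simps)

text \<open>A line has empty interior. This supplies witnesses for the side of an edge on which a
  face lies.\<close>

lemma open_off_line:
  assumes "open S" "S \<noteq> {}" "a \<noteq> b"
  obtains x where "x \<in> S" "orient a b x \<noteq> 0"
proof (rule ccontr)
  assume "\<not> thesis"
  with that have 0: "\<forall>x\<in>S. orient a b x = 0" by blast
  have "S \<subseteq> {x. normal a b \<bullet> x = normal a b \<bullet> a}"
    using 0 orient_diff_inner[of a b _ a] by (force simp: inner_diff_right)
  then have "S \<subseteq> interior {x. normal a b \<bullet> x = normal a b \<bullet> a}"
    using assms(1) by (intro interior_maximal) auto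
  then show False using assms(2) interior_hyperplane[OF normal_nonzero[OF assms(3)]] by auto
qed

lemma in_symmetric_segment:
  fixes v y :: point
  assumes "y \<noteq> 0"
  shows "v \<in> open_segment (v + y) (v - y)"
proof -
  have "v = midpoint (v + y) (v - y)" by (simp add: midpoint_def scaleR_2[symmetric])
  then show ?thesis
    using assms by (metis add_cancel_right_right midpoint_eq_endpoint(1) midpoint_in_open_segment)
qed

lemma eventually_segment_positive:
  assumes "(\<alpha>::real) > 0"
  obtains t\<^sub>0 where "0 < t\<^sub>0" "t\<^sub>0 \<le> 1" "\<And>t. 0 \<le> t \<Longrightarrow> t \<le> t\<^sub>0 \<Longrightarrow> (1 - t) * \<alpha> + t * \<beta> > 0"
proof
  \<comment> \<open>Up to this bound \<open>t * (\<alpha> + \<bar>\<beta>\<bar>)\<close> stays at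
    most \<open>\<alpha> / 2\<close>, so the perturbed value keeps at least half of
    \<open>\<alpha>\<close>.\<close>
  let ?t = "\<alpha> / (2 * (\<alpha> + \<bar>\<beta>\<bar>))"
  show "0 < ?t" "?t \<le> 1" using assms by (auto simp: field_simps)
  fix t assume t: "0 \<le> t" "t \<le> ?t"
  have "t * (\<alpha> + \<bar>\<beta>\<bar>) \<le> ?t * (\<alpha> + \<bar>\<beta>\<bar>)" using t assms by (intro mult_right_mono) auto
  also have "\<dots> = \<alpha> / 2" using assms by (simp add: field_simps)
  finally have "t * \<alpha> + t * \<bar>\<beta>\<bar> \<le> \<alpha> / 2" by (simp add: algebra_simps)
  moreover have "- (t * \<bar>\<beta>\<bar>) \<le> t * \<beta>"
    using t(1) mult_left_mono[of "-\<bar>\<beta>\<bar>" \<beta> t] by auto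
  ultimately show "(1 - t) * \<alpha> + t * \<beta> > 0" using assms by (simp add: algebra_simps)
qed

text \<open>At an inner point \<open>m\<close> of the side \<open>a b\<close>, two of the three area
  conditions are strict and persist for a short while, and the third becomes strict as soon as one
  moves to the side of \<open>w\<close>. This is the local form of every crossing argument
  below.\<close>

lemma triangle_entered:
  assumes m: "m \<in> open_segment a b" and wc: "orient a b w * orient a b c > 0"
  shows "\<exists>t\<^sub>0>0. t\<^sub>0 \<le> 1 \<and>
    (\<forall>t. 0 < t \<and> t \<le> t\<^sub>0 \<longrightarrow> (1 - t) *\<^sub>R m + t *\<^sub>R c \<in> interior (convex hull {a, b, w}))"
proof -
  have *: "\<exists>t\<^sub>0>0. t\<^sub>0 \<le> 1 \<and>
    (\<forall>t. 0 < t \<and> t \<le> t\<^sub>0 \<longrightarrow> (1 - t) *\<^sub>R m + t *\<^sub>R c \<in> interior (convex hull {a, b, w}))"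
    if m: "m \<in> open_segment a b" and pos: "orient a b w > 0" "orient a b c > 0" for a b
  proof -
    obtain s where s: "0 < s" "s < 1" "m = (1 - s) *\<^sub>R a + s *\<^sub>R b"
      using m by (auto simp: in_segment)
    have "orient b w m = (1 - s) * orient a b w" "orient w a m = s * orient a b w"
      unfolding s(3) orient_segment using orient_rotate[of a b w] orient_rotate[of b w a]
      by simp_all
    then have "orient b w m > 0" "orient w a m > 0" using s pos by auto
    moreover have ab: "orient a b m = 0" unfolding s(3) orient_segment by simp
    ultimately obtain t1 t2 where
       t1: "0 < t1" "t1 \<le> 1" "\<And>t. 0 \<le> t \<Longrightarrow> t \<le> t1 \<Longrightarrow> (1 - t) * orient b w m + t * orient b w c > 0" and
       t2: "0 < t2" "t2 \<le> 1" "\<And>t. 0 \<le> t \<Longrightarrow> t \<le> t2 \<Longrightarrow> (1 - t) * orient w a m + t * orient w a c > 0"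
      using eventually_segment_positive by metis
    show ?thesis
    proof (intro exI conjI allI impI)
      show "0 < min t1 t2" "min t1 t2 \<le> 1" using t1 t2 by auto
      fix t assume t: "0 < t \<and> t \<le> min t1 t2"
      then show "(1 - t) *\<^sub>R m + t *\<^sub>R c \<in> interior (convex hull {a, b, w})"
        using t1(3)[of t] t2(3)[of t] pos ab
        by (simp add: interior_triangle_iff orient_segment)
    qed
  qed
  show ?thesis
  proof (cases "orient a b w > 0")
    case True
    then show ?thesis using wc m *[of a b] by (auto simp: zero_less_mult_iff)
  next
    case False
    with wc have "orient b a w > 0" "orient b a c > 0"
      by (auto simp: zero_less_mult_iff orient_swap[of b a])
    moreover have "m \<in> open_segment b a" using m by (simp add: open_segment_commute)
    ultimately show ?thesis using *[of b a] by (simp add: insert_commute)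
  qed
qed

lemma finite_maximum:
  fixes f :: "'a \<Rightarrow> 'b::linorder"
  assumes "W \<noteq> {}" "finite W"
  shows "\<exists>p\<in>W. \<forall>x\<in>W. f x \<le> f p"
proof -
  have "Max (f ` W) \<in> f ` W" using assms by (intro Max_in) auto
  then obtain p where "p \<in> W" "Max (f ` W) = f p" by blast
  then show ?thesis using Max_ge[of "f ` W"] assms(2) by (metis finite_imageI imageI)
qed

section \<open>Points in general position and plane graphs\<close>

lemma polygon_sideE:
  assumes "e \<in> polygon_sides A"
  obtains a b where "e = {a, b}" "a \<noteq> b" "a extreme_point_of A" "b extreme_point_of A"
    "closed_segment a b face_of A"
proof -
  obtain a b where ab: "e = {a, b}" "closed_segment a b face_of A" "aff_dim (closed_segment a b) = 1"
    using assms by (auto simp: polygon_sides_def edge_of_def)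
  have "a \<noteq> b" using ab(3) by auto
  moreover have "a extreme_point_of closed_segment a b" "b extreme_point_of closed_segment a b"
    by (auto simp: extreme_point_of_segment)
  ultimately show thesis using that ab extreme_point_of_face by blast
qed

text \<open>In the plane the facets of a full-dimensional polytope are its one-dimensional faces;
  these are compact, convex and collinear, hence segments.\<close>

lemma boundary_eq_sides:
  assumes "convex_polygon A"
  shows "A - interior A = (\<Union>e\<in>polygon_sides A. convex hull e)"
proof -
  have A: "polytope A" "interior A \<noteq> {}" using assms by (auto simp: convex_polygon_def)
  have dim: "aff_dim A = 2" using aff_dim_nonempty_interior[OF A(2)] by simp
  have "{F. F facet_of A} = (\<lambda>e. convex hull e) ` polygon_sides A"
  proof (intro equalityI subsetI)
    fix F assume "F \<in> {F. F facet_of A}"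
    then have F: "F face_of A" "aff_dim F = 1" "F \<noteq> {}" using dim by (auto simp: facet_of_def)
    have "compact F" "convex F"
      using F(1) A(1) face_of_polytope_polytope polytope_imp_compact polytope_imp_convex by blast+
    then obtain a b where "F = closed_segment a b"
      using compact_convex_collinear_segment F(2,3) by (metis collinear_aff_dim order_refl)
    moreover from this have "{a, b} \<in> polygon_sides A"
      using F by (auto simp: polygon_sides_def edge_of_def)
    ultimately show "F \<in> (\<lambda>e. convex hull e) ` polygon_sides A"
      by (auto simp: segment_convex_hull)
  next
    fix F assume "F \<in> (\<lambda>e. convex hull e) ` polygon_sides A"
    then show "F \<in> {F. F facet_of A}"
      using dim by (auto simp: polygon_sides_def edge_of_def facet_of_def segment_convex_hull)
  qed
  moreover have "rel_interior A = interior A"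
    by (rule rel_interior_nonempty_interior[OF A(2)])
  ultimately show ?thesis
    using rel_boundary_of_polyhedron[OF polytope_imp_polyhedron[OF A(1)]] by simp
qed

lemma closed_polygon: "convex_polygon A \<Longrightarrow> closed A"
  by (simp add: convex_polygon_def polytope_imp_closed)

lemma convex_polygon_convex: "convex_polygon A \<Longrightarrow> convex A"
  by (simp add: convex_polygon_def polytope_imp_convex)

lemma polygon_eq_closure_interior: "convex_polygon A \<Longrightarrow> closure (interior A) = A"
  by (metis closed_polygon closure_closed convex_closure_interior convex_polygon_convex convex_polygon_def)

definition edge_set :: "point set \<Rightarrow> point set set \<Rightarrow> bool" where
  "edge_set P E \<longleftrightarrow> (\<forall>e\<in>E. \<exists>a\<in>P. \<exists>b\<in>P. a \<noteq> b \<and> e = {a, b})"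

definition drawing :: "point set set \<Rightarrow> point set" where
  "drawing E = (\<Union>e\<in>E. convex hull e)"

definition neighbours :: "point set set \<Rightarrow> point \<Rightarrow> point set" where
  "neighbours E v = {x. {x, v} \<in> E}"

lemma edge_setE:
  assumes "edge_set P E" "e \<in> E"
  obtains a b where "a \<in> P" "b \<in> P" "a \<noteq> b" "e = {a, b}"
  using assms by (auto simp: edge_set_def)

lemma finite_edge_set:
  assumes "finite P" "edge_set P E"
  shows "finite E"
proof -
  have "E \<subseteq> Pow P" using assms(2) by (auto simp: edge_set_def)
  then show ?thesis using assms(1) finite_subset by blast
qed

lemma compact_drawing:
  assumes "finite P" "edge_set P E"
  shows "compact (drawing E)"
  unfolding drawing_def
proof (rule compact_UN)
  show "finite E" by (rule finite_edge_set[OF assms])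
  fix e assume "e \<in> E"
  then show "compact (convex hull e)"
    using assms(2) by (auto simp: edge_set_def intro!: finite_imp_compact_convex_hull)
qed

lemma neighbours_subset:
  assumes "edge_set P E" shows "neighbours E v \<subseteq> P - {v}"
  using assms by (force simp: edge_set_def neighbours_def doubleton_eq_iff)

lemma in_open_segment_iff: "m \<in> convex hull {a, b} \<and> m \<noteq> a \<and> m \<noteq> b \<longleftrightarrow> m \<in> open_segment a b"
  by (auto simp: open_segment_def segment_convex_hull)

lemma orient_on_segment: "m \<in> convex hull {a, b} \<Longrightarrow> orient a b m = 0"
  by (auto simp: segment_convex_hull[symmetric] in_segment orient_segment)

text \<open>\<open>orient c d\<close> is affine along \<open>a b\<close>, and an affine function
  with two zeros on a line vanishes on all of it.\<close>

lemma orient_line_unique: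
  assumes "m \<noteq> n" "m \<in> convex hull {a, b}" "n \<in> convex hull {a, b}" "orient c d m = 0" "orient c d n = 0"
  shows "orient c d a = 0" "orient c d b = 0"
proof -
  obtain s t where s: "m = (1 - s) *\<^sub>R a + s *\<^sub>R b" and t: "n = (1 - t) *\<^sub>R a + t *\<^sub>R b"
    using assms(2,3) by (auto simp: segment_convex_hull[symmetric] in_segment)
  have "s \<noteq> t" using assms(1) s t by auto
  define u v where "u = orient c d a" and "v = orient c d b"
  have 1: "(1 - s) * u + s * v = 0" and 2: "(1 - t) * u + t * v = 0"
    using assms(4,5) unfolding s t orient_segment u_def v_def by auto
  have "(s - t) * (v - u) = 0" using 1 2 by algebra
  then have "u = v" using \<open>s \<noteq> t\<close> by simp
  with 1 have "u = 0" by (simp add: algebra_simps)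
  with \<open>u = v\<close> show "orient c d a = 0" "orient c d b = 0" by (simp_all add: u_def v_def)
qed

text \<open>A locale, because contraction needs the whole theory a second time for the point set
  \<open>P - {u}\<close>.\<close>

locale points =
  fixes P :: "point set"
  assumes finite_P: "finite P" and card_P: "card P \<ge> 3" and gp: "general_position P"
begin

lemma orient_nonzero:
  "\<lbrakk>a \<in> P; b \<in> P; c \<in> P; a \<noteq> b; a \<noteq> c; b \<noteq> c\<rbrakk> \<Longrightarrow> orient a b c \<noteq> 0"
  using gp by (simp add: general_position_def collinear_iff_orient)

lemma orient_zeroD:
  "\<lbrakk>orient a b c = 0; a \<in> P; b \<in> P; c \<in> P; a \<noteq> b\<rbrakk> \<Longrightarrow> c = a \<or> c = b"
  using orient_nonzero by metis

lemma on_segmentD: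
  assumes "p \<in> convex hull {a, b}" "a \<in> P" "b \<in> P" "p \<in> P"
  shows "p = a \<or> p = b"
proof (cases "a = b")
  case True
  then show ?thesis using assms by simp
next
  case False
  then show ?thesis using orient_zeroD[OF orient_on_segment[OF assms(1)]] assms by blast
qed

lemma hull_interior_nonempty: "interior (convex hull P) \<noteq> {}"
proof -
  obtain T where T: "T \<subseteq> P" "card T = 3"
    using card_P by (metis obtain_subset_with_card_n)
  then obtain a b c where abc: "T = {a, b, c}" "a \<noteq> b" "a \<noteq> c" "b \<noteq> c"
    by (auto simp: card_3_iff)
  then have "orient a b c \<noteq> 0" using orient_nonzero T(1) by auto
  then have "interior (convex hull T) \<noteq> {}" using interior_triangle_empty_iff abc by metis
  then show ?thesis using interior_mono[OF hull_mono[OF T(1)]] by blast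
qed

lemma hull_polygon: "convex_polygon (convex hull P)"
  using finite_P hull_interior_nonempty by (auto simp: convex_polygon_def polytope_def)

lemma closed_hull: "closed (convex hull P)"
  by (simp add: closed_polygon hull_polygon)

lemma hull_side_ends:
  assumes "{a, b} \<in> polygon_sides (convex hull P)"
  shows "a extreme_point_of convex hull P" "b extreme_point_of convex hull P" "a \<noteq> b"
  using polygon_sideE[OF assms] by (auto simp: doubleton_eq_iff)

lemma edge_set_hull_sides: "edge_set P (polygon_sides (convex hull P))"
  unfolding edge_set_def by (meson polygon_sideE extreme_point_of_convex_hull)

text \<open>A point of \<open>P\<close> on the hull boundary lies on a side with ends in
  \<open>P\<close>; by general position it is one of these ends, hence extreme.\<close>

lemma nonextreme_interior:
  assumes "v \<in> P" "\<not> v extreme_point_of convex hull P"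
  shows "v \<in> interior (convex hull P)"
proof (rule ccontr)
  assume "v \<notin> interior (convex hull P)"
  then have "v \<in> convex hull P - interior (convex hull P)" using assms(1) hull_inc by fast
  then obtain e where e: "e \<in> polygon_sides (convex hull P)" "v \<in> convex hull e"
    using boundary_eq_sides[OF hull_polygon] by auto
  then obtain a b where "e = {a, b}" "a extreme_point_of convex hull P" "b extreme_point_of convex hull P"
    by (meson polygon_sideE)
  then show False
    using on_segmentD[of v a b] e(2) assms extreme_point_of_convex_hull by blast
qed

lemma interior_iff_nonextreme:
  "v \<in> P \<Longrightarrow> v \<in> interior (convex hull P) \<longleftrightarrow> \<not> v extreme_point_of convex hull P"
  using nonextreme_interior extreme_point_not_in_interior by blast

lemma edge_unique:
  assumes "{a, b} \<subseteq> P" "{c, d} \<subseteq> P" "a \<noteq> b" "c \<noteq> d"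
    and "m \<noteq> n" "m \<in> convex hull {a, b}" "n \<in> convex hull {a, b}"
    and "m \<in> convex hull {c, d}" "n \<in> convex hull {c, d}"
  shows "{a, b} = {c, d}"
proof -
  have "orient c d a = 0" "orient c d b = 0"
    using orient_line_unique[OF assms(5-7)] orient_on_segment assms(8,9) by blast+
  then have "a = c \<or> a = d" "b = c \<or> b = d"
    using orient_zeroD[of c d] assms by auto
  then show ?thesis using assms by auto
qed

text \<open>Finitely many edges cover the infinite set \<open>a b\<close>, so one edge shares two
  points with it and equals it by general position. Hence a drawing, as a mere point set, determines
  its edges.\<close>

lemma segment_in_drawing:
  assumes "a \<in> P" "b \<in> P" "a \<noteq> b" and E: "edge_set P E" and sub: "convex hull {a, b} \<subseteq> drawing E"
  shows "{a, b} \<in> E"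
proof -
  have "infinite (closed_segment a b)" using assms(3) by (simp add: uncountable_closed_segment uncountable_infinite)
  moreover have "closed_segment a b = (\<Union>e\<in>E. closed_segment a b \<inter> convex hull e)"
    using sub by (auto simp: drawing_def segment_convex_hull)
  moreover have "finite E" by (rule finite_edge_set[OF finite_P E])
  ultimately obtain e where e: "e \<in> E" "infinite (closed_segment a b \<inter> convex hull e)"
    by (metis finite_UN)
  obtain c d where cd: "c \<in> P" "d \<in> P" "c \<noteq> d" "e = {c, d}" using edge_setE[OF E e(1)] .
  obtain m n where mn: "m \<in> closed_segment a b \<inter> convex hull e" "n \<in> closed_segment a b \<inter> convex hull e" "m \<noteq> n"
    using e(2) by (metis finite.emptyI finite.insertI finite_subset insertI1 subsetI singleton_iff)
  have "{a, b} = {c, d}"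
    by (rule edge_unique[OF _ _ _ _ mn(3)]) (use assms cd mn in \<open>auto simp: segment_convex_hull\<close>)
  then show ?thesis using e(1) cd by simp
qed

text \<open>The description of skeletons without polygons. The last condition concerns one vertex
  and its neighbours at a time, so the effect of deleting or contracting an edge can be checked
  locally.\<close>

definition convex_graph :: "point set set \<Rightarrow> bool" where
  "convex_graph E \<longleftrightarrow> edge_set P E \<and> polygon_sides (convex hull P) \<subseteq> E \<and>
     (\<forall>e\<in>E. \<forall>f\<in>E. e \<noteq> f \<longrightarrow> convex hull e \<inter> convex hull f \<subseteq> e \<inter> f) \<and>
     (\<forall>v\<in>P. \<not> v extreme_point_of convex hull P \<longrightarrow> v \<in> interior (convex hull (neighbours E v)))"

lemma convex_graphD:
  assumes "convex_graph E"
  shows "edge_set P E" "polygon_sides (convex hull P) \<subseteq> E"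
    "\<lbrakk>e \<in> E; f \<in> E; e \<noteq> f; m \<in> convex hull e; m \<in> convex hull f\<rbrakk> \<Longrightarrow> m \<in> e \<and> m \<in> f"
    "\<lbrakk>v \<in> P; \<not> v extreme_point_of convex hull P\<rbrakk> \<Longrightarrow> v \<in> interior (convex hull (neighbours E v))"
  using assms unfolding convex_graph_def by blast+

lemma drawing_subset_hull: "edge_set P E \<Longrightarrow> drawing E \<subseteq> convex hull P"
  unfolding drawing_def edge_set_def by (intro UN_least hull_mono) auto

lemma hull_boundary_subset_drawing:
  "polygon_sides (convex hull P) \<subseteq> E \<Longrightarrow> convex hull P - interior (convex hull P) \<subseteq> drawing E"
  unfolding boundary_eq_sides[OF hull_polygon] drawing_def by auto

end

section \<open>The skeleton of a decomposition\<close>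

context points
begin

lemma decompositionD:
  assumes "convex_decomposition P D"
  shows "A \<in> D \<Longrightarrow> convex_polygon A" "A \<in> D \<Longrightarrow> x extreme_point_of A \<Longrightarrow> x \<in> P"
    "\<lbrakk>A \<in> D; B \<in> D; A \<noteq> B\<rbrakk> \<Longrightarrow> interior A \<inter> interior B = {}"
    "\<Union>D = convex hull P" "A \<in> D \<Longrightarrow> P \<inter> interior A = {}"
  using assms by (auto simp: convex_decomposition_def polygon_vertices_def pairwise_def)

lemma skeletonE:
  assumes "convex_decomposition P D" "e \<in> skeleton_edges D"
  obtains A a b where "A \<in> D" "e = {a, b}" "a \<noteq> b" "a \<in> P" "b \<in> P"
    "a extreme_point_of A" "b extreme_point_of A" "e \<in> polygon_sides A"
proof -
  obtain A where A: "A \<in> D" "e \<in> polygon_sides A" using assms(2) by (auto simp: skeleton_edges_def)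
  obtain a b where ab: "e = {a, b}" "a \<noteq> b" "a extreme_point_of A" "b extreme_point_of A"
    using polygon_sideE[OF A(2)] by metis
  show thesis
    by (rule that[OF A(1) ab(1,2) _ _ ab(3,4) A(2)]) (use decompositionD(2)[OF assms(1) A(1)] ab in auto)
qed

lemma edge_set_skeleton:
  assumes "convex_decomposition P D"
  shows "edge_set P (skeleton_edges D)"
  unfolding edge_set_def
proof
  fix e assume "e \<in> skeleton_edges D"
  then obtain A a b where "e = {a, b}" "a \<noteq> b" "a \<in> P" "b \<in> P" by (rule skeletonE[OF assms])
  then show "\<exists>a\<in>P. \<exists>b\<in>P. a \<noteq> b \<and> e = {a, b}" by blast
qed

text \<open>A side of \<open>B\<close> lies in \<open>B\<close>, the closure of its interior, and an
  open set disjoint from \<open>interior B\<close> is also disjoint from that closure.\<close>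

lemma skeleton_avoids_interior:
  assumes D: "convex_decomposition P D" and e: "e \<in> skeleton_edges D" and "A \<in> D"
  shows "convex hull e \<inter> interior A = {}"
proof -
  obtain B where B: "B \<in> D" "e \<in> polygon_sides B"
    using e by (auto simp: skeleton_edges_def)
  have polyB: "convex_polygon B" using decompositionD(1)[OF D B(1)] .
  have *: "convex hull e \<subseteq> B - interior B" using boundary_eq_sides[OF polyB] B(2) by auto
  show ?thesis
  proof (cases "A = B")
    case True
    then show ?thesis using * by blast
  next
    case False
    then have "interior A \<inter> interior B = {}" using decompositionD(3)[OF D] assms(3) B(1) by blast
    then have "interior A \<inter> closure (interior B) = {}"
      using open_Int_closure_eq_empty[of "interior A" "interior B"] by simp
    then show ?thesis using * polygon_eq_closure_interior[OF polyB] by auto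
  qed
qed

lemma drawing_skeleton:
  assumes D: "convex_decomposition P D"
  shows "drawing (skeleton_edges D) = convex hull P - (\<Union>A\<in>D. interior A)"
proof
  show "drawing (skeleton_edges D) \<subseteq> convex hull P - (\<Union>A\<in>D. interior A)"
    using drawing_subset_hull[OF edge_set_skeleton[OF D]] skeleton_avoids_interior[OF D]
    unfolding drawing_def by blast
  show "convex hull P - (\<Union>A\<in>D. interior A) \<subseteq> drawing (skeleton_edges D)"
  proof
    fix x assume x: "x \<in> convex hull P - (\<Union>A\<in>D. interior A)"
    then obtain A where A: "A \<in> D" "x \<in> A" using decompositionD(4)[OF D] by blast
    then have "x \<in> A - interior A" using x by blast
    then show "x \<in> drawing (skeleton_edges D)"
      using boundary_eq_sides[OF decompositionD(1)[OF D A(1)]] A(1)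
      unfolding drawing_def skeleton_edges_def by auto
  qed
qed

text \<open>No open face reaches the hull boundary, so a hull side is covered by the drawing;
  \<open>segment_in_drawing\<close> then makes it a single edge.\<close>

lemma hull_sides_in_skeleton:
  assumes D: "convex_decomposition P D"
  shows "polygon_sides (convex hull P) \<subseteq> skeleton_edges D"
proof
  fix e assume e: "e \<in> polygon_sides (convex hull P)"
  obtain a b where ab: "e = {a, b}" "a \<noteq> b" "a \<in> P" "b \<in> P"
    by (rule edge_setE[OF edge_set_hull_sides e])
  have "convex hull e \<subseteq> convex hull P - interior (convex hull P)"
    using boundary_eq_sides[OF hull_polygon] e by auto
  moreover have "(\<Union>A\<in>D. interior A) \<subseteq> interior (convex hull P)"
    using decompositionD(4)[OF D] interior_mono by blast
  ultimately have "convex hull e \<subseteq> drawing (skeleton_edges D)"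
    unfolding drawing_skeleton[OF D] by blast
  then show "e \<in> skeleton_edges D"
    using segment_in_drawing[OF ab(3,4,2) edge_set_skeleton[OF D]] ab(1) by simp
qed

text \<open>An end of \<open>{c, d}\<close> on the line \<open>a b\<close> would, together with
  \<open>m\<close>, pull both ends onto it, and general position would identify the edges. So both
  values are nonzero, and a proper weighted mean of them vanishes at \<open>m\<close>.\<close>

lemma crossing_sides:
  assumes P: "a \<in> P" "b \<in> P" "c \<in> P" "d \<in> P" and "a \<noteq> b" "c \<noteq> d" "{a, b} \<noteq> {c, d}"
    and m: "m \<in> convex hull {a, b}" "m \<in> convex hull {c, d}" "m \<notin> P"
  shows "orient a b c * orient a b d < 0"
proof -
  have abm: "orient a b m = 0" by (rule orient_on_segment[OF m(1)])
  have ne: "orient a b c \<noteq> 0 \<and> orient a b d \<noteq> 0"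
  proof (rule ccontr)
    assume "\<not> ?thesis"
    then obtain x where x: "x \<in> {c, d}" "orient a b x = 0" by blast
    have "m \<noteq> x" using x(1) m(3) P by blast
    moreover have "x \<in> convex hull {c, d}" by (rule hull_inc[OF x(1)])
    ultimately have "orient a b c = 0" "orient a b d = 0"
      using orient_line_unique[of m x c d a b] x(2) m(2) abm by simp_all
    then have "c = a \<or> c = b" "d = a \<or> d = b"
      using orient_zeroD[of a b c] orient_zeroD[of a b d] P \<open>a \<noteq> b\<close> by simp_all
    then show False using \<open>c \<noteq> d\<close> \<open>{a, b} \<noteq> {c, d}\<close> by auto
  qed
  have "m \<in> open_segment c d" using m P in_open_segment_iff[of m c d] by auto
  then obtain s where s: "0 < s" "s < 1" "m = (1 - s) *\<^sub>R c + s *\<^sub>R d" by (auto simp: in_segment)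
  have 0: "(1 - s) * orient a b c + s * orient a b d = 0" using abm unfolding s(3) orient_segment .
  have "(1 - s) * (orient a b c * orient a b c) + s * (orient a b c * orient a b d) = 0"
    using 0 by algebra
  moreover have "(1 - s) * (orient a b c * orient a b c) > 0"
    using s ne by (metis diff_gt_0_iff_gt mult_pos_pos not_real_square_gt_zero)
  ultimately have "s * (orient a b c * orient a b d) < 0" by linarith
  then show ?thesis using s(1) by (simp add: mult_less_0_iff)
qed

text \<open>If \<open>f\<close> crosses a side \<open>a b\<close> of the polygon \<open>A\<close>,
  then one end of \<open>f\<close> lies on the side of \<open>a b\<close> where \<open>A\<close> is,
  and moving along \<open>f\<close> towards it enters the interior of \<open>A\<close>.\<close>

lemma skeleton_crossing_free:
  assumes D: "convex_decomposition P D" and e: "e \<in> skeleton_edges D" and f: "f \<in> skeleton_edges D"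
    and "e \<noteq> f" and m: "m \<in> convex hull e" "m \<in> convex hull f"
  shows "m \<in> e \<inter> f"
proof (rule ccontr)
  assume nm: "m \<notin> e \<inter> f"
  obtain A a b where A: "A \<in> D" "e = {a, b}" "a \<noteq> b" "a \<in> P" "b \<in> P"
    "a extreme_point_of A" "b extreme_point_of A"
    by (rule skeletonE[OF D e])
  obtain c d where cd: "f = {c, d}" "c \<noteq> d" "c \<in> P" "d \<in> P" by (rule skeletonE[OF D f])
  have "m \<notin> P"
    using nm m on_segmentD[of m a b] on_segmentD[of m c d] A(4,5) cd(3,4) unfolding A(2) cd(1) by auto
  then have mo: "m \<in> open_segment a b"
    using m A(4,5) in_open_segment_iff[of m a b] unfolding A(2) by auto
  have convA: "convex A" using convex_polygon_convex decompositionD(1)[OF D A(1)] by blast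
  have abA: "a \<in> A" "b \<in> A" using A(6,7) by (auto simp: extreme_point_of_def)
  have "interior A \<noteq> {}" using decompositionD(1)[OF D A(1)] by (simp add: convex_polygon_def)
  \<comment> \<open>\<open>w\<close> marks the side of \<open>a b\<close> on which \<open>A\<close>
    lies; the triangle \<open>a b w\<close> is contained in \<open>A\<close>.\<close>
  then obtain w where "w \<in> interior A" and w0: "orient a b w \<noteq> 0"
    by (rule open_off_line[OF open_interior _ A(3)])
  then have w: "w \<in> A" "orient a b w \<noteq> 0" using interior_subset by auto
  have "orient a b c * orient a b d < 0"
    using crossing_sides[OF A(4,5) cd(3,4) A(3) cd(2)] \<open>e \<noteq> f\<close> m \<open>m \<notin> P\<close> unfolding A(2) cd(1) by blast
  then have "\<exists>x\<in>{c,d}. orient a b w * orient a b x > 0"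
    using w(2) by (auto simp: zero_less_mult_iff mult_less_0_iff)
  then obtain x where x: "x \<in> f" "orient a b w * orient a b x > 0" using cd by blast
  obtain t where t: "t > 0" "t \<le> 1" "(1 - t) *\<^sub>R m + t *\<^sub>R x \<in> interior (convex hull {a, b, w})"
    using triangle_entered[OF mo x(2)] by blast
  have "convex hull {a, b, w} \<subseteq> A" using abA w convA by (intro hull_minimal) auto
  then have "(1 - t) *\<^sub>R m + t *\<^sub>R x \<in> interior A" using t(3) interior_mono by blast
  moreover have "(1 - t) *\<^sub>R m + t *\<^sub>R x \<in> convex hull f"
    using m(2) x(1) t convexD[OF convex_convex_hull, of m f x "1 - t" t] hull_inc[of x f convex] by simp
  ultimately show False using skeleton_avoids_interior[OF D f A(1)] by blast
qed

section \<open>Inner vertices of a skeleton are surrounded by their neighbours\<close>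

lemma half_disc_connected:
  fixes v :: point
  shows "connected (ball v r \<inter> {x. w \<bullet> (x - v) > 0})"
proof -
  have "{x. w \<bullet> (x - v) > 0} = {x. w \<bullet> x > w \<bullet> v}" by (auto simp: inner_diff_right)
  then show ?thesis by (simp add: convex_Int convex_connected convex_halfspace_gt)
qed

lemma connected_in_one_polygon:
  assumes D: "convex_decomposition P D" and H: "connected H" "H \<noteq> {}" "H \<subseteq> (\<Union>A\<in>D. interior A)"
  obtains A where "A \<in> D" "H \<subseteq> interior A"
proof -
  obtain x A where x: "x \<in> H" "A \<in> D" "x \<in> interior A" using H by blast
  have "H \<subseteq> interior A"
  proof (rule ccontr)
    assume "\<not> H \<subseteq> interior A"
    then have "(\<Union>B\<in>D - {A}. interior B) \<inter> H \<noteq> {}" using H(3) by blast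
    moreover have "interior A \<inter> (\<Union>B\<in>D - {A}. interior B) \<inter> H = {}"
      using decompositionD(3)[OF D x(2)] by fastforce
    moreover have "H \<subseteq> interior A \<union> (\<Union>B\<in>D - {A}. interior B)" using H(3) by blast
    moreover have "open (\<Union>B\<in>D - {A}. interior B)" by auto
    moreover have "interior A \<inter> H \<noteq> {}" using x by blast
    ultimately show False
      using connectedD[OF H(1) open_interior[of A]] by metis
  qed
  then show thesis using that x by blast
qed

text \<open>If all neighbours of \<open>v\<close> lay in a closed half-plane, a small open half disc
  at \<open>v\<close> on the other side would meet no edge and so lie in one face \<open>A\<close>.
  Then \<open>A\<close> contains a diameter with midpoint \<open>v\<close>, although
  \<open>v\<close>, being a point of \<open>P\<close> on a side of \<open>A\<close>, is extreme in
  \<open>A\<close>.\<close>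

lemma skeleton_surrounds:
  assumes D: "convex_decomposition P D" and v: "v \<in> P" "\<not> v extreme_point_of convex hull P"
  shows "v \<in> interior (convex hull (neighbours (skeleton_edges D) v))"
proof (rule ccontr)
  let ?E = "skeleton_edges D"
  have E: "edge_set P ?E" by (rule edge_set_skeleton[OF D])
  assume "v \<notin> interior (convex hull (neighbours ?E v))"
  then obtain w where w: "w \<noteq> 0" "\<forall>x\<in>neighbours ?E v. w \<bullet> (x - v) \<le> 0"
    by (auto simp: not_in_interior_convex_hull_iff)
  \<comment> \<open>The edges missing \<open>v\<close> have a closed drawing that avoids
    \<open>v\<close>, so in a small disc around \<open>v\<close> only the edges ending at
    \<open>v\<close> are left.\<close>
  let ?F = "{e \<in> ?E. v \<notin> e}"
  have F: "edge_set P ?F" using E by (auto simp: edge_set_def)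
  have vF: "v \<notin> drawing ?F"
  proof
    assume "v \<in> drawing ?F"
    then obtain e where e: "e \<in> ?E" "v \<notin> e" "v \<in> convex hull e" by (auto simp: drawing_def)
    obtain a b where "a \<in> P" "b \<in> P" "e = {a, b}" by (rule edge_setE[OF E e(1)])
    then show False using on_segmentD[of v a b] v(1) e(2,3) by auto
  qed
  have "open (interior (convex hull P) - drawing ?F)"
    using compact_drawing[OF finite_P F] by (intro open_Diff compact_imp_closed) auto
  moreover have "v \<in> interior (convex hull P) - drawing ?F" using vF nonextreme_interior[OF v] by blast
  ultimately obtain r where r: "r > 0" "ball v r \<subseteq> interior (convex hull P) - drawing ?F"
    by (meson openE)
  define H where "H = ball v r \<inter> {x. w \<bullet> (x - v) > 0}"
  have inH: "v + x \<in> H" if "norm x < r" "w \<bullet> x > 0" for x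
    using that by (auto simp: H_def dist_norm)
  have "H \<noteq> {}"
  proof -
    have "v + (r / (2 * norm w)) *\<^sub>R w \<in> H" using w(1) r(1) by (intro inH) auto
    then show ?thesis by blast
  qed
  have Hd: "H \<inter> drawing ?E = {}"
  proof -
    have "x \<notin> convex hull e" if x: "x \<in> H" and e: "e \<in> ?E" for x e
    proof
      assume xe: "x \<in> convex hull e"
      show False
      proof (cases "v \<in> e")
        case False
        then have "x \<in> drawing ?F" using e xe by (auto simp: drawing_def)
        then show False using x r(2) by (auto simp: H_def)
      next
        case True
        obtain a b where "e = {a, b}" by (rule edge_setE[OF E e])
        then obtain y where y: "e = {y, v}" using True by blast
        then have "w \<bullet> (y - v) \<le> 0" using w(2) e by (auto simp: neighbours_def)
        then have "e \<subseteq> {z. w \<bullet> z \<le> w \<bullet> v}" using y by (auto simp: inner_diff_right)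
        then have "convex hull e \<subseteq> {z. w \<bullet> z \<le> w \<bullet> v}" by (intro hull_minimal convex_halfspace_le)
        then show False using xe x by (auto simp: H_def inner_diff_right)
      qed
    qed
    then show ?thesis by (auto simp: drawing_def)
  qed
  have "H \<subseteq> (\<Union>A\<in>D. interior A)"
    using Hd r(2) interior_subset[of "convex hull P"] unfolding drawing_skeleton[OF D] H_def by blast
  then obtain A where A: "A \<in> D" "H \<subseteq> interior A"
    using connected_in_one_polygon[OF D] half_disc_connected[of v r w] \<open>H \<noteq> {}\<close> H_def by metis
  have polyA: "convex_polygon A" using decompositionD(1)[OF D A(1)] .
  \<comment> \<open>Points on the diameter of the half disc are limits of points shifted slightly in
    direction \<open>w\<close>.\<close>
  have cl: "v + y \<in> A" if y: "w \<bullet> y = 0" "norm y < r" for y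
  proof -
    have "v + y \<in> closure H"
      unfolding closure_approachable
    proof (intro allI impI)
      fix \<epsilon> :: real assume "\<epsilon> > 0"
      define \<delta> where "\<delta> = min (\<epsilon> / 2) ((r - norm y) / 2)"
      have \<delta>: "\<delta> > 0" "\<delta> < \<epsilon>" "norm y + \<delta> < r" using \<open>\<epsilon> > 0\<close> y(2) by (auto simp: \<delta>_def min_def field_simps)
      let ?z = "y + (\<delta> / norm w) *\<^sub>R w"
      have "norm ?z \<le> norm y + \<delta>" using norm_triangle_ineq[of y "(\<delta> / norm w) *\<^sub>R w"] w(1) \<delta>(1) by simp
      moreover have "w \<bullet> ?z > 0" using y(1) w(1) \<delta>(1) by (simp add: inner_add_right)
      ultimately have "v + ?z \<in> H" using \<delta> by (intro inH) auto
      moreover have "dist (v + ?z) (v + y) < \<epsilon>" using w(1) \<delta> by (simp add: dist_norm)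
      ultimately show "\<exists>z\<in>H. dist z (v + y) < \<epsilon>" by blast
    qed
    moreover have "closure H \<subseteq> A"
      using A(2) interior_subset closed_polygon[OF polyA] closure_minimal by (metis subset_trans)
    ultimately show ?thesis by blast
  qed
  obtain y where y: "y \<noteq> 0" "w \<bullet> y = 0" "norm y < r"
  proof -
    let ?y = "vector [- (w$2), w$1] :: point"
    have 0: "?y \<noteq> 0" "w \<bullet> ?y = 0"
      using w(1) by (auto simp: point_eq_iff inner_vec_def sum_2)
    show thesis
      by (rule that[of "(r / (2 * norm ?y)) *\<^sub>R ?y"]) (use 0 r(1) in auto)
  qed
  have "v \<in> A" using cl[of 0] r(1) by simp
  then have "v \<in> A - interior A" using decompositionD(5)[OF D A(1)] v(1) by blast
  then obtain e where e: "e \<in> polygon_sides A" "v \<in> convex hull e"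
    using boundary_eq_sides[OF polyA] by auto
  obtain a b where ab: "e = {a, b}" "a extreme_point_of A" "b extreme_point_of A"
    by (rule polygon_sideE[OF e(1)])
  then have "v extreme_point_of A"
    using on_segmentD[of v a b] e(2) v(1) decompositionD(2)[OF D A(1)] by blast
  moreover have "v \<in> open_segment (v + y) (v - y)" by (rule in_symmetric_segment[OF y(1)])
  ultimately show False
    using cl[of y] cl[of "-y"] y by (auto simp: extreme_point_of_def)
qed

lemma convex_graph_skeleton:
  assumes "convex_decomposition P D"
  shows "convex_graph (skeleton_edges D)"
  unfolding convex_graph_def
proof (intro conjI ballI impI)
  show "edge_set P (skeleton_edges D)" by (rule edge_set_skeleton[OF assms])
  show "polygon_sides (convex hull P) \<subseteq> skeleton_edges D" by (rule hull_sides_in_skeleton[OF assms])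
  show "convex hull e \<inter> convex hull f \<subseteq> e \<inter> f"
    if "e \<in> skeleton_edges D" "f \<in> skeleton_edges D" "e \<noteq> f" for e f
    using skeleton_crossing_free[OF assms that] by blast
  show "v \<in> interior (convex hull (neighbours (skeleton_edges D) v))"
    if "v \<in> P" "\<not> v extreme_point_of convex hull P" for v
    by (rule skeleton_surrounds[OF assms that])
qed

text \<open>Without interior edges the open hull would be a connected set free of edges, hence
  inside a single open face, with no room for a second polygon.\<close>

lemma interior_edge_exists:
  assumes D: "convex_decomposition P D" and card: "card D > 1"
  obtains e where "interior_edge P D e"
proof (rule ccontr)
  assume "\<not> thesis"
  with that have "skeleton_edges D \<subseteq> polygon_sides (convex hull P)" by (auto simp: interior_edge_def)
  then have "drawing (skeleton_edges D) \<inter> interior (convex hull P) = {}"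
    using boundary_eq_sides[OF hull_polygon] unfolding drawing_def by blast
  then have "interior (convex hull P) \<subseteq> (\<Union>A\<in>D. interior A)"
    using interior_subset unfolding drawing_skeleton[OF D] by blast
  then obtain A where A: "A \<in> D" "interior (convex hull P) \<subseteq> interior A"
    using connected_in_one_polygon[OF D] hull_interior_nonempty
    by (metis convex_connected convex_convex_hull convex_interior)
  have "\<not> D \<subseteq> {A}" using card card_mono[of "{A}" D] by auto
  then obtain B where B: "B \<in> D" "B \<noteq> A" by blast
  have "interior B \<subseteq> interior (convex hull P)" using decompositionD(4)[OF D] B(1) interior_mono by blast
  moreover have "interior B \<noteq> {}" using decompositionD(1)[OF D B(1)] by (simp add: convex_polygon_def)
  ultimately show False using A decompositionD(3)[OF D B(1) A(1) B(2)] by blast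
qed

end

section \<open>Faces of a convex graph\<close>

context points
begin

text \<open>Its components are the open faces of the decomposition to be constructed.\<close>

definition free_region :: "point set set \<Rightarrow> point set" where
  "free_region E = interior (convex hull P) - drawing E"

lemma open_free_region: "edge_set P E \<Longrightarrow> open (free_region E)"
  unfolding free_region_def using compact_drawing[OF finite_P]
  by (intro open_Diff compact_imp_closed) auto

text \<open>A point of the drawing on \<open>pq\<close> would give a vertex of the graph on \<open>pq\<close>, all of whose
  edges leave on one side of \<open>pq\<close>.\<close>

lemma free_segment_of_triangle:
  assumes E: "convex_graph E" and pqr: "orient p q r \<noteq> 0"
    and p: "p \<in> free_region E" and q: "q \<in> free_region E"
    and tri: "interior (convex hull {p, q, r}) \<subseteq> free_region E"
    and z: "z \<in> open_segment p q"
  shows "z \<in> free_region E"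
proof (rule ccontr)
  have ES: "edge_set P E" using convex_graphD(1)[OF E] .
  have pq: "p \<noteq> q" using pqr by auto
  have on_line: "orient p q y = 0" if "y \<in> open_segment p q" for y
    using that orient_on_segment[of y p q] by (simp add: segment_convex_hull[symmetric] open_segment_def)
  have in_hull: "y \<in> interior (convex hull P)" if "y \<in> open_segment p q" for y
  proof -
    have "closed_segment p q \<subseteq> interior (convex hull P)"
      using p q by (intro closed_segment_subset) (auto simp: free_region_def)
    then show ?thesis using that segment_open_subset_closed by blast
  qed
  \<comment> \<open>From a point of an edge on \<open>p q\<close> one cannot move along the edge
    towards the side of \<open>r\<close>, since this would enter the free triangle.\<close>
  have side: "orient p q r * orient p q x \<le> 0"
    if y: "y \<in> open_segment p q" and e: "e \<in> E" "y \<in> convex hull e" "x \<in> e" for y e x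
  proof (rule ccontr)
    assume "\<not> ?thesis"
    then obtain t where t: "t > 0" "t \<le> 1" "(1 - t) *\<^sub>R y + t *\<^sub>R x \<in> interior (convex hull {p, q, r})"
      using triangle_entered[OF y, of r x] by (meson less_eq_real_def linorder_not_le)
    have "(1 - t) *\<^sub>R y + t *\<^sub>R x \<in> convex hull e"
      using t e hull_inc[of x e convex] by (intro convexD[OF convex_convex_hull]) auto
    then show False using t(3) tri e(1) by (auto simp: free_region_def drawing_def)
  qed
  have no_vertex: False if y: "y \<in> P" "y \<in> open_segment p q" for y
  proof -
    have "\<not> y extreme_point_of convex hull P" using in_hull[OF y(2)] interior_iff_nonextreme y(1) by blast
    then have "y \<in> interior (convex hull (neighbours E y))" using convex_graphD(4)[OF E] y(1) by blast
    moreover have "(orient p q r *\<^sub>R normal p q) \<bullet> (x - y) \<le> 0" if "x \<in> neighbours E y" for x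
      using side[OF y(2), of "{x, y}" x] that hull_inc[of y "{x, y}" convex]
        orient_diff_inner[of p q x y] on_line[OF y(2)] by (simp add: neighbours_def)
    moreover have "orient p q r *\<^sub>R normal p q \<noteq> 0" using pqr normal_nonzero[OF pq] by simp
    ultimately show False using not_in_interior_convex_hull_iff by blast
  qed
  assume "z \<notin> free_region E"
  then obtain e where e: "e \<in> E" "z \<in> convex hull e"
    using in_hull[OF z] by (auto simp: free_region_def drawing_def)
  obtain a b where ab: "a \<in> P" "b \<in> P" "e = {a, b}" by (rule edge_setE[OF ES e(1)])
  have "z \<noteq> a" "z \<noteq> b" using no_vertex z ab by blast+
  obtain s where s: "0 \<le> s" "s \<le> 1" "z = (1 - s) *\<^sub>R a + s *\<^sub>R b"
    using e(2) ab(3) by (auto simp: segment_convex_hull[symmetric] in_segment)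
  have s01: "0 < s" "s < 1" using s \<open>z \<noteq> a\<close> \<open>z \<noteq> b\<close> by (auto simp: less_le)
  \<comment> \<open>Both ends are weakly on the side away from \<open>r\<close>, and a proper
    weighted mean vanishes at \<open>z\<close>; so the whole edge lies on the line
    \<open>p q\<close>.\<close>
  have "orient p q a = 0 \<and> orient p q b = 0"
  proof -
    let ?A = "orient p q r * orient p q a" and ?B = "orient p q r * orient p q b"
    have "?A \<le> 0" "?B \<le> 0" using side[OF z e] ab(3) by auto
    moreover have "orient p q z = (1 - s) * orient p q a + s * orient p q b"
      unfolding s(3) by (rule orient_segment)
    then have "(1 - s) * ?A + s * ?B = 0" using on_line[OF z] by algebra
    ultimately have "(1 - s) * ?A = 0" "s * ?B = 0"
      using s01 mult_nonneg_nonpos[of "1 - s" ?A] mult_nonneg_nonpos[of s ?B] by linarith+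
    then show ?thesis using s01 pqr by simp
  qed
  \<comment> \<open>Positions along the line, with \<open>p\<close> at 0 and \<open>q\<close> at
    1.\<close>
  then obtain \<alpha> \<beta> where \<alpha>: "a = (1 - \<alpha>) *\<^sub>R p + \<alpha> *\<^sub>R q" and \<beta>: "b = (1 - \<beta>) *\<^sub>R p + \<beta> *\<^sub>R q"
    using orient_zero_param[OF _ pq] by metis
  obtain \<zeta> where \<zeta>: "0 < \<zeta>" "\<zeta> < 1" "z = (1 - \<zeta>) *\<^sub>R p + \<zeta> *\<^sub>R q" using z by (auto simp: in_segment)
  have "(\<zeta> - ((1 - s) * \<alpha> + s * \<beta>)) *\<^sub>R (q - p) = 0"
    using s(3) \<zeta>(3) unfolding \<alpha> \<beta> by (simp add: algebra_simps)
  then have comb: "\<zeta> = (1 - s) * \<alpha> + s * \<beta>" using pq by simp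
  \<comment> \<open>The edge avoids the free points \<open>p\<close> and \<open>q\<close>. Since it
    contains \<open>z\<close>, which lies strictly between them, it cannot extend past either, so
    its end \<open>a\<close> is a vertex inside \<open>p q\<close>.\<close>
  have off: "(1 - l) * \<alpha> + l * \<beta> \<noteq> 0 \<and> (1 - l) * \<alpha> + l * \<beta> \<noteq> 1" if "0 \<le> l" "l \<le> 1" for l
  proof -
    have eq: "(1 - l) *\<^sub>R a + l *\<^sub>R b = (1 - ((1 - l) * \<alpha> + l * \<beta>)) *\<^sub>R p + ((1 - l) * \<alpha> + l * \<beta>) *\<^sub>R q"
      unfolding \<alpha> \<beta> by (simp add: algebra_simps)
    have "(1 - l) *\<^sub>R a + l *\<^sub>R b \<in> convex hull e"
      using that unfolding ab(3) segment_convex_hull[symmetric] in_segment by blast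
    then have "(1 - l) *\<^sub>R a + l *\<^sub>R b \<in> drawing E" using e(1) by (auto simp: drawing_def)
    then have "(1 - l) *\<^sub>R a + l *\<^sub>R b \<noteq> p" "(1 - l) *\<^sub>R a + l *\<^sub>R b \<noteq> q"
      using p q by (auto simp: free_region_def)
    then show ?thesis unfolding eq by auto
  qed
  have "0 < \<alpha>"
  proof (rule ccontr)
    assume "\<not> 0 < \<alpha>"
    have "s * \<beta> > 0" using comb \<zeta>(1) s01 \<open>\<not> 0 < \<alpha>\<close> mult_nonneg_nonpos[of "1 - s" \<alpha>] by linarith
    then have "\<beta> > 0" using s01 by (simp add: zero_less_mult_iff)
    then show False using off[of "- \<alpha> / (\<beta> - \<alpha>)"] \<open>\<not> 0 < \<alpha>\<close> by (simp add: field_simps)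
  qed
  moreover have "\<alpha> < 1"
  proof (rule ccontr)
    assume "\<not> \<alpha> < 1"
    have "s * (1 - \<beta>) = (1 - \<zeta>) - (1 - s) * (1 - \<alpha>)" unfolding comb by (simp add: algebra_simps)
    moreover have "(1 - s) * (1 - \<alpha>) \<le> 0"
      using s01 \<open>\<not> \<alpha> < 1\<close> by (intro mult_nonneg_nonpos) auto
    ultimately have "s * (1 - \<beta>) > 0" using \<zeta>(2) by linarith
    then have "\<beta> < 1" using s01 by (simp add: zero_less_mult_iff)
    define l where "l = (\<alpha> - 1) / (\<alpha> - \<beta>)"
    have l: "0 \<le> l" "l \<le> 1" "l * (\<alpha> - \<beta>) = \<alpha> - 1"
      using \<open>\<beta> < 1\<close> \<open>\<not> \<alpha> < 1\<close> by (auto simp: l_def field_simps)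
    have "(1 - l) * \<alpha> + l * \<beta> = \<alpha> - l * (\<alpha> - \<beta>)" by (simp add: algebra_simps)
    then show False using off[OF l(1,2)] l(3) by simp
  qed
  ultimately have "a \<in> open_segment p q" using \<alpha> pq by (auto simp: in_segment)
  then show False using no_vertex ab(1) by blast
qed

text \<open>Sweep \<open>p x\<close> while \<open>x\<close> moves from \<open>r\<close> to \<open>q\<close>, and look at the first segment that is not free.\<close>

lemma free_segment_trans:
  assumes E: "convex_graph E"
    and pr: "closed_segment p r \<subseteq> free_region E" and rq: "closed_segment r q \<subseteq> free_region E"
  shows "closed_segment p q \<subseteq> free_region E"
proof (rule ccontr)
  assume "\<not> ?thesis"
  then obtain s1 where s1: "0 \<le> s1" "s1 \<le> 1" "(1 - s1) *\<^sub>R p + s1 *\<^sub>R q \<notin> free_region E"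
    by (auto simp: in_segment subset_iff)
  \<comment> \<open>\<open>g (t, s)\<close> is the point at parameter \<open>s\<close> on the
    segment from \<open>p\<close> to the point at parameter \<open>t\<close> of \<open>r q\<close>.
    The pairs with a point that is not free form the compact set \<open>K\<close>, hence a least
    such \<open>t\<close> exists.\<close>
  define g where "g = (\<lambda>x::real \<times> real. (1 - snd x) *\<^sub>R p + snd x *\<^sub>R ((1 - fst x) *\<^sub>R r + fst x *\<^sub>R q))"
  define K where "K = ({0..1} \<times> {0..1}) \<inter> g -` (- free_region E)"
  have "closed (g -` (- free_region E))"
    unfolding g_def using open_free_region[OF convex_graphD(1)[OF E]]
    by (intro closed_vimage continuous_intros) (auto simp: closed_def)
  then have "compact K" unfolding K_def by (intro compact_Int_closed compact_Times) auto
  moreover have "(1, s1) \<in> K" using s1 by (simp add: K_def g_def)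
  ultimately have "compact (fst ` K)" "fst ` K \<noteq> {}"
    by (auto intro!: compact_continuous_image continuous_intros)
  then obtain T where T: "T \<in> fst ` K" "\<And>t. t \<in> fst ` K \<Longrightarrow> T \<le> t"
    using compact_attains_inf[of "fst ` K"] by blast
  then obtain s where s: "(T, s) \<in> K" by force
  define q' where "q' = (1 - T) *\<^sub>R r + T *\<^sub>R q"
  define z where "z = (1 - s) *\<^sub>R p + s *\<^sub>R q'"
  have T01: "0 \<le> T" "T \<le> 1" and s01: "0 \<le> s" "s \<le> 1" and znot: "z \<notin> free_region E"
    using s by (auto simp: K_def g_def z_def q'_def)
  have q'in: "q' \<in> closed_segment r q" using T01 by (auto simp: q'_def in_segment)
  have pin: "p \<in> free_region E" "r \<in> free_region E" "q' \<in> free_region E" using pr rq q'in by auto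
  have rq': "closed_segment r q' \<subseteq> free_region E"
    using rq q'in subset_closed_segment[of r q' r q] by auto
  have zin: "z \<in> closed_segment p q'" using s01 by (auto simp: z_def in_segment)
  then have zo: "z \<in> open_segment p q'" using pin znot by (auto simp: open_segment_def)
  show False
  proof (cases "orient p q' r = 0")
    case True
    \<comment> \<open>In the degenerate case one of the three points lies between the other two, and
      \<open>p q'\<close> is covered by two free segments.\<close>
    have "closed_segment p q' \<subseteq> closed_segment p r \<union> closed_segment r q'"
    proof -
      from True have "p \<in> closed_segment q' r \<or> q' \<in> closed_segment r p \<or> r \<in> closed_segment p q'"
        using collinear_iff_orient[of p q' r] collinear_between_cases[of p q' r] by (simp add: between_mem_segment)
      then show ?thesis
      proof (elim disjE)
        assume "p \<in> closed_segment q' r"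
        then have "closed_segment p q' \<subseteq> closed_segment q' r" by (simp add: subset_closed_segment)
        then show ?thesis by (simp add: closed_segment_commute le_supI2)
      next
        assume "q' \<in> closed_segment r p"
        then have "closed_segment p q' \<subseteq> closed_segment r p" by (simp add: subset_closed_segment)
        then show ?thesis by (simp add: closed_segment_commute le_supI1)
      next
        assume "r \<in> closed_segment p q'"
        then show ?thesis using Un_closed_segment[of r p q'] by simp
      qed
    qed
    then show False using zin znot pr rq' by blast
  next
    case False
    have "interior (convex hull {p, q', r}) \<subseteq> free_region E"
    proof
      fix x assume x: "x \<in> interior (convex hull {p, q', r})"
      have "\<not> collinear {p, q', r}" using False by (simp add: collinear_iff_orient)
      then obtain a b c where abc: "0 < a" "0 < b" "0 < c" "a + b + c = 1"
        and xe: "x = a *\<^sub>R p + b *\<^sub>R q' + c *\<^sub>R r"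
        using interior_convex_hull_3_minimal[of p q' r] x by auto
      \<comment> \<open>Projecting \<open>x\<close> from \<open>p\<close> onto \<open>r q'\<close>
        gives relative position \<open>b / (b + c)\<close> there, that is, \<open>t\<close> on
        \<open>r q\<close>. As \<open>t < T\<close>, the minimality of \<open>T\<close> makes
        \<open>x\<close> free.\<close>
      define t where "t = b / (b + c) * T"
      have "T > 0"
      proof (rule ccontr)
        assume "\<not> T > 0"
        then have "q' = r" using T01 by (simp add: q'_def)
        then show False using False by simp
      qed
      have t: "0 \<le> t" "t < T" using abc T01 \<open>T > 0\<close> by (auto simp: t_def field_simps)
      have bc: "0 \<le> b + c" "b + c \<le> 1" using abc by auto
      have "(b + c) * t = b * T" using abc by (simp add: t_def)
      moreover have "(b + c) * (1 - t) = (b + c) - (b + c) * t" by (simp add: algebra_simps)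
      ultimately have eq: "(b + c) *\<^sub>R ((1 - t) *\<^sub>R r + t *\<^sub>R q) = ((b + c) - b * T) *\<^sub>R r + (b * T) *\<^sub>R q"
        by (simp add: scaleR_right_distrib)
      have "1 - (b + c) = a" using abc by simp
      then have "g (t, b + c) = a *\<^sub>R p + (((b + c) - b * T) *\<^sub>R r + (b * T) *\<^sub>R q)"
        unfolding g_def fst_conv snd_conv eq by simp
      also have "\<dots> = x" unfolding xe q'_def by (simp add: algebra_simps)
      finally have gx: "g (t, b + c) = x" .
      have "(t, b + c) \<notin> K" using T(2)[of t] t(2) by force
      then show "x \<in> free_region E" using gx t T01 bc by (auto simp: K_def)
    qed
    then have "z \<in> free_region E"
      using free_segment_of_triangle[OF E False pin(1,3) _ zo] by blast
    then show False using znot by blast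
  qed
qed

text \<open>Being joined by a free segment is a symmetric and, by \<open>free_segment_trans\<close>,
  transitive relation that holds locally; on a connected set it therefore holds between any two
  points.\<close>

lemma component_convex:
  assumes E: "convex_graph E" and C: "C \<in> components (free_region E)"
  shows "convex C"
proof -
  let ?U = "free_region E"
  have U: "open ?U" using open_free_region convex_graphD(1)[OF E] by blast
  have "closed_segment a b \<subseteq> ?U" if ab: "a \<in> C" "b \<in> C" for a b
  proof (rule connected_equivalence_relation[OF in_components_connected[OF C] ab])
    show "closed_segment y x \<subseteq> ?U" if "closed_segment x y \<subseteq> ?U" for x y
      using that by (simp add: closed_segment_commute)
    show "closed_segment x z \<subseteq> ?U" if "closed_segment x y \<subseteq> ?U" "closed_segment y z \<subseteq> ?U" for x y z
      using free_segment_trans[OF E that] .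
    fix x assume "x \<in> C"
    then have "x \<in> ?U" using in_components_subset[OF C] by blast
    then obtain r where r: "r > 0" "ball x r \<subseteq> ?U" using U openE by blast
    show "\<exists>T. openin (top_of_set C) T \<and> x \<in> T \<and> (\<forall>y\<in>T. closed_segment x y \<subseteq> ?U)"
    proof (intro exI conjI ballI)
      show "openin (top_of_set C) (C \<inter> ball x r)" by (simp add: openin_open_Int)
      show "x \<in> C \<inter> ball x r" using \<open>x \<in> C\<close> r(1) by simp
      fix y assume "y \<in> C \<inter> ball x r"
      then have "closed_segment x y \<subseteq> ball x r" using r(1) by (intro closed_segment_subset) auto
      then show "closed_segment x y \<subseteq> ?U" using r(2) by blast
    qed
  qed
  then have "closed_segment a b \<subseteq> C" if "a \<in> C" "b \<in> C" for a b
    using components_maximal[OF C connected_segment(1)] that by blast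
  then show ?thesis by (simp add: convex_contains_segment)
qed


section \<open>Closures of the components as polygons with vertices in \<open>P\<close>\<close>

lemma component_open:
  assumes "convex_graph E" "C \<in> components (free_region E)"
  shows "open C"
  using open_components open_free_region convex_graphD(1) assms by blast

lemma interior_closure_component:
  assumes "convex_graph E" "C \<in> components (free_region E)"
  shows "interior (closure C) = C"
  using convex_interior_closure[OF component_convex[OF assms]] component_open[OF assms]
  by (simp add: interior_open)

lemma closure_component_subset:
  assumes "convex_graph E" "C \<in> components (free_region E)"
  shows "closure C \<subseteq> convex hull P"
proof (rule closure_minimal[OF _ closed_hull])
  show "C \<subseteq> convex hull P"
    using in_components_subset[OF assms(2)] interior_subset by (auto simp: free_region_def)
qed

lemma segment_parametrization_subset:
  assumes "0 < s" "s < 1" "z = (1 - s) *\<^sub>R a + s *\<^sub>R b" "\<bar>\<delta>\<bar> \<le> min s (1 - s)"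
  shows "z + \<delta> *\<^sub>R (b - a) \<in> convex hull {a, b}"
proof -
  have "z + \<delta> *\<^sub>R (b - a) = (1 - (s + \<delta>)) *\<^sub>R a + (s + \<delta>) *\<^sub>R b"
    unfolding assms(3) by (simp add: algebra_simps)
  moreover have "0 \<le> s + \<delta>" "s + \<delta> \<le> 1" using assms(4) by auto
  ultimately show ?thesis unfolding segment_convex_hull[symmetric] in_segment by blast
qed

text \<open>Otherwise \<open>z\<close> is an inner point of an edge \<open>e\<close>, and no other
  edge comes near it. The part of a small disc on the side of \<open>e\<close> where
  \<open>C\<close> is present then belongs to \<open>C\<close>, so \<open>closure C\<close> contains
  a piece of \<open>e\<close> around \<open>z\<close>.\<close>

lemma extreme_point_of_component:
  assumes E: "convex_graph E" and C: "C \<in> components (free_region E)"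
    and z: "z extreme_point_of closure C"
  shows "z \<in> P"
proof (rule ccontr)
  assume zP: "z \<notin> P"
  have ES: "edge_set P E" using convex_graphD(1)[OF E] .
  have opC: "open C" by (rule component_open[OF E C])
  have zcl: "z \<in> closure C" using z by (simp add: extreme_point_of_def)
  have zC: "z \<notin> C"
    using extreme_point_not_in_interior[OF z] interior_closure_component[OF E C] by simp
  have "z \<notin> free_region E"
  proof
    assume "z \<in> free_region E"
    then obtain C' where C': "C' \<in> components (free_region E)" "z \<in> C'"
      using Union_components[of "free_region E"] by blast
    then have "C' \<inter> C \<noteq> {}"
      using component_open[OF E C'(1)] zcl open_Int_closure_eq_empty by blast
    then show False using components_nonoverlap[OF C'(1) C] C'(2) zC by blast
  qed
  moreover have "z \<in> convex hull P" using closure_component_subset[OF E C] zcl by blast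
  ultimately have "z \<in> drawing E"
    using hull_boundary_subset_drawing[OF convex_graphD(2)[OF E]] by (auto simp: free_region_def)
  then obtain e where e: "e \<in> E" "z \<in> convex hull e" by (auto simp: drawing_def)
  obtain a b where ab: "a \<in> P" "b \<in> P" "a \<noteq> b" "e = {a, b}" by (rule edge_setE[OF ES e(1)])
  have "z \<in> open_segment a b" using e(2) zP ab by (simp add: in_open_segment_iff[symmetric]) blast
  then obtain s where s: "0 < s" "s < 1" "z = (1 - s) *\<^sub>R a + s *\<^sub>R b" by (auto simp: in_segment)
  let ?F = "E - {e}"
  have F: "edge_set P ?F" using ES by (auto simp: edge_set_def)
  have "z \<notin> drawing ?F"
  proof
    assume "z \<in> drawing ?F"
    then obtain f where f: "f \<in> E" "f \<noteq> e" "z \<in> convex hull f" by (auto simp: drawing_def)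
    then have "z \<in> e" using convex_graphD(3)[OF E f(1) e(1) f(2) f(3) e(2)] by blast
    then show False using zP ab by blast
  qed
  moreover have "closed (drawing ?F)" by (rule compact_imp_closed[OF compact_drawing[OF finite_P F]])
  ultimately obtain r where r: "r > 0" "ball z r \<subseteq> - drawing ?F"
    using openE[of "- drawing ?F" z] by blast
  have "open (C \<inter> ball z r)" using opC by auto
  moreover have "C \<inter> ball z r \<noteq> {}"
    using zcl open_Int_closure_eq_empty[of "ball z r" C] r(1) centre_in_ball by blast
  ultimately obtain x where x: "x \<in> C" "x \<in> ball z r" and x0: "orient a b x \<noteq> 0"
    using open_off_line[of "C \<inter> ball z r" a b] ab(3) by blast
  define n where "n = orient a b x *\<^sub>R normal a b"
  have nz: "n \<bullet> (y - z) = orient a b x * orient a b y" for y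
  proof -
    have "orient a b z = 0" using orient_on_segment[of z a b] e(2) ab(4) by simp
    then show ?thesis using orient_diff_inner[of a b y z] by (simp add: n_def)
  qed
  \<comment> \<open>The intersection with the open hull also covers edges on the hull boundary;
    \<open>H\<close> stays convex, hence connected.\<close>
  define H where "H = ball z r \<inter> interior (convex hull P) \<inter> {y. n \<bullet> (y - z) > 0}"
  have convH: "convex H"
  proof -
    have "{y. n \<bullet> (y - z) > 0} = {y. n \<bullet> y > n \<bullet> z}" by (auto simp: inner_diff_right)
    then show ?thesis by (simp add: H_def convex_Int convex_interior convex_halfspace_gt)
  qed
  have xH: "x \<in> H" using x x0 in_components_subset[OF C] nz[of x]
    by (auto simp: H_def free_region_def zero_less_mult_iff linorder_neq_iff)
  have HC: "H \<subseteq> C"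
  proof (rule components_maximal[OF C])
    show "connected H" by (rule convex_connected[OF convH])
    show "C \<inter> H \<noteq> {}" using xH x by blast
    show "H \<subseteq> free_region E"
    proof
      fix y assume y: "y \<in> H"
      have "y \<notin> convex hull e"
        using orient_on_segment[of y a b] nz[of y] y ab(4) by (auto simp: H_def)
      moreover have "y \<notin> drawing ?F" using y r(2) by (auto simp: H_def)
      ultimately have "y \<notin> drawing E" by (auto simp: drawing_def)
      then show "y \<in> free_region E" using y by (simp add: H_def free_region_def)
    qed
  qed
  have on_side: "z + \<delta> *\<^sub>R (b - a) \<in> closure C"
    if \<delta>: "\<bar>\<delta>\<bar> \<le> min s (1 - s)" "\<bar>\<delta>\<bar> * norm (b - a) < r" for \<delta>
  proof -
    let ?y = "z + \<delta> *\<^sub>R (b - a)"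
    have yh: "?y \<in> convex hull {a, b}" by (rule segment_parametrization_subset[OF s \<delta>(1)])
    have "convex hull {a, b} \<subseteq> convex hull P" using ab by (intro hull_mono) auto
    then have yP: "?y \<in> convex hull P" using yh by blast
    have y0: "n \<bullet> (?y - z) = 0" using nz[of ?y] orient_on_segment[OF yh] by simp
    have "open_segment ?y x \<subseteq> H"
    proof
      fix u assume u: "u \<in> open_segment ?y x"
      have "?y \<in> ball z r" using \<delta>(2) by (simp add: dist_norm)
      then have "closed_segment ?y x \<subseteq> ball z r" using x(2) by (intro closed_segment_subset convex_ball)
      then have "u \<in> ball z r" using u segment_open_subset_closed[of ?y x] by blast
      moreover have "u \<in> interior (convex hull P)"
        using in_interior_closure_convex_segment[OF convex_convex_hull, of x P ?y] xH yP u
          closure_subset[of "convex hull P"]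
        by (auto simp: H_def open_segment_commute)
      moreover have "n \<bullet> (u - z) > 0"
      proof -
        obtain t where t: "0 < t" "u = (1 - t) *\<^sub>R ?y + t *\<^sub>R x" using u unfolding in_segment by blast
        have "u - z = (1 - t) *\<^sub>R (?y - z) + t *\<^sub>R (x - z)" unfolding t(2) by (simp add: algebra_simps)
        then have "n \<bullet> (u - z) = (1 - t) * (n \<bullet> (?y - z)) + t * (n \<bullet> (x - z))"
          by (simp only: inner_add_right inner_scaleR_right)
        then have "n \<bullet> (u - z) = t * (n \<bullet> (x - z))" unfolding y0 by simp
        then show ?thesis using t(1) xH by (simp add: H_def)
      qed
      ultimately show "u \<in> H" by (simp add: H_def)
    qed
    moreover have "?y \<noteq> x" using y0 xH by (auto simp: H_def)
    ultimately have "?y \<in> closure H"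
      using closure_mono[of "open_segment ?y x" H] closure_open_segment[of ?y x] by (auto split: if_splits)
    then show ?thesis using closure_mono[OF HC] by blast
  qed
  \<comment> \<open>Short enough to stay on the edge in both directions and, by the factor 2,
    strictly inside the disc.\<close>
  define \<delta> where "\<delta> = min (min s (1 - s)) (r / (2 * norm (b - a)))"
  have "\<delta> > 0" using s r(1) ab(3) by (simp add: \<delta>_def)
  have "\<delta> * norm (b - a) \<le> r / (2 * norm (b - a)) * norm (b - a)"
    by (intro mult_right_mono) (auto simp: \<delta>_def)
  also have "\<dots> < r" using ab(3) r(1) by simp
  finally have "\<delta> * norm (b - a) < r" .
  moreover have "\<delta> \<le> min s (1 - s)" unfolding \<delta>_def by (rule min.cobounded1)
  ultimately have "z + \<delta> *\<^sub>R (b - a) \<in> closure C" "z - \<delta> *\<^sub>R (b - a) \<in> closure C"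
    using on_side[of \<delta>] on_side[of "- \<delta>"] \<open>\<delta> > 0\<close> by simp_all
  moreover have "z \<in> open_segment (z + \<delta> *\<^sub>R (b - a)) (z - \<delta> *\<^sub>R (b - a))"
    using \<open>\<delta> > 0\<close> ab(3) by (intro in_symmetric_segment) simp
  ultimately show False using z by (auto simp: extreme_point_of_def)
qed

lemma component_closure_hull:
  assumes E: "convex_graph E" and C: "C \<in> components (free_region E)"
  obtains X where "X \<subseteq> P" "closure C = convex hull X"
proof -
  have "bounded (closure C)"
    using closure_component_subset[OF E C] finite_P
    by (meson bounded_subset compact_imp_bounded finite_imp_compact_convex_hull)
  then have "compact (closure C)" by (simp add: compact_eq_bounded_closed)
  moreover have "convex (closure C)" by (rule convex_closure[OF component_convex[OF E C]])
  ultimately have "closure C = convex hull {x. x extreme_point_of closure C}"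
    by (rule Krein_Milman_Minkowski)
  moreover have "{x. x extreme_point_of closure C} \<subseteq> P" using extreme_point_of_component[OF E C] by blast
  ultimately show thesis by (rule that[rotated])
qed

text \<open>A component is recovered from the extreme points of its closure, a subset of
  \<open>P\<close>.\<close>

lemma finite_components_free_region:
  assumes E: "convex_graph E"
  shows "finite (components (free_region E))"
proof (rule finite_subset)
  show "components (free_region E) \<subseteq> (\<lambda>X. interior (convex hull X)) ` Pow P"
  proof
    fix C assume C: "C \<in> components (free_region E)"
    obtain X where "X \<subseteq> P" "closure C = convex hull X" by (rule component_closure_hull[OF E C])
    then show "C \<in> (\<lambda>X. interior (convex hull X)) ` Pow P"
      using interior_closure_component[OF E C] by (metis PowI image_eqI)
  qed
  show "finite ((\<lambda>X. interior (convex hull X)) ` Pow P)" using finite_P by simp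
qed

lemma vertices_in_drawing:
  assumes E: "convex_graph E" and v: "v \<in> P" "v \<in> interior (convex hull P)"
  shows "v \<in> drawing E"
proof -
  have "v \<in> interior (convex hull (neighbours E v))"
    using convex_graphD(4)[OF E] v interior_iff_nonextreme by blast
  then have "neighbours E v \<noteq> {}" by auto
  then obtain x where "{x, v} \<in> E" by (auto simp: neighbours_def)
  then show ?thesis using hull_inc[of v "{x, v}" convex] by (auto simp: drawing_def)
qed

lemma interior_drawing_empty:
  assumes "edge_set P E"
  shows "interior (drawing E) = {}"
proof -
  have "finite E" by (rule finite_edge_set[OF finite_P assms])
  then show ?thesis using assms
  proof (induction E)
    case empty
    then show ?case by (simp add: drawing_def)
  next
    case (insert e E)
    then have E: "edge_set P E" by (simp add: edge_set_def)
    obtain a b where "e = {a, b}" using insert.prems by (auto simp: edge_set_def)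
    then have "interior (convex hull e) = {}"
      using interior_triangle_empty_iff[of a a b] by simp
    moreover have "drawing (insert e E) = drawing E \<union> convex hull e" by (auto simp: drawing_def)
    ultimately show ?case
      using insert.IH[OF E] interior_closed_Un_empty_interior[of "drawing E" "convex hull e"]
        compact_imp_closed[OF compact_drawing[OF finite_P E]] by simp
  qed
qed

text \<open>The drawing has empty interior, so the free region is dense in the hull; finiteness of
  the components makes the union of their closures closed.\<close>

lemma Union_closure_components:
  assumes E: "convex_graph E"
  shows "\<Union>(closure ` components (free_region E)) = convex hull P"
proof
  show "\<Union>(closure ` components (free_region E)) \<subseteq> convex hull P"
    using closure_component_subset[OF E] by blast
  have "interior (convex hull P) \<subseteq> closure (free_region E)"
  proof -
    have "closure (- drawing E) = UNIV"
      using interior_drawing_empty[OF convex_graphD(1)[OF E]] by (simp add: closure_complement)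
    then have "interior (convex hull P) \<subseteq> closure (interior (convex hull P) \<inter> - drawing E)"
      using open_Int_closure_subset[of "interior (convex hull P)" "- drawing E"] by simp
    then show ?thesis by (simp add: free_region_def Diff_eq)
  qed
  then have "closure (interior (convex hull P)) \<subseteq> closure (free_region E)"
    by (simp add: closure_minimal)
  then have "convex hull P \<subseteq> closure (free_region E)"
    using polygon_eq_closure_interior[OF hull_polygon] by simp
  also have "closure (free_region E) \<subseteq> \<Union>(closure ` components (free_region E))"
  proof (rule closure_minimal)
    show "free_region E \<subseteq> \<Union>(closure ` components (free_region E))"
      using Union_components[of "free_region E"] closure_subset by blast
    show "closed (\<Union>(closure ` components (free_region E)))"
      using finite_components_free_region[OF E] by (intro closed_Union) auto
  qed
  finally show "convex hull P \<subseteq> \<Union>(closure ` components (free_region E))" .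
qed

text \<open>Converse of \<open>convex_graph_skeleton\<close>. The skeleton obtained is
  \<open>E\<close> itself, because both drawings are the hull without the free region and a drawing
  determines its edges.\<close>

lemma convex_graph_decomposition:
  assumes E: "convex_graph E"
  shows "convex_decomposition P (closure ` components (free_region E))"
    and "skeleton_edges (closure ` components (free_region E)) = E"
proof -
  let ?Cs = "components (free_region E)" and ?D = "closure ` components (free_region E)"
  have ES: "edge_set P E" using convex_graphD(1)[OF E] .
  show D: "convex_decomposition P ?D"
    unfolding convex_decomposition_def polygon_vertices_def
  proof (intro conjI)
    show "\<forall>A\<in>?D. convex_polygon A \<and> {x. x extreme_point_of A} \<subseteq> P"
    proof
      fix A assume "A \<in> ?D"
      then obtain C where C: "C \<in> ?Cs" "A = closure C" by blast
      obtain X where X: "X \<subseteq> P" "closure C = convex hull X" by (rule component_closure_hull[OF E C(1)])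
      have "polytope A"
        unfolding C(2) X(2) polytope_def using finite_subset[OF X(1) finite_P] by blast
      moreover have "interior A \<noteq> {}"
        using interior_closure_component[OF E C(1)] in_components_nonempty[OF C(1)] C(2) by simp
      ultimately show "convex_polygon A \<and> {x. x extreme_point_of A} \<subseteq> P"
        using extreme_point_of_component[OF E C(1)] C(2) by (auto simp: convex_polygon_def)
    qed
    show "pairwise (\<lambda>A B. interior A \<inter> interior B = {}) ?D"
      using components_nonoverlap interior_closure_component[OF E]
      by (fastforce simp: pairwise_def)
    show "\<Union>?D = convex hull P" by (rule Union_closure_components[OF E])
    show "\<forall>A\<in>?D. P \<inter> interior A = {}"
    proof
      fix A assume "A \<in> ?D"
      then obtain C where C: "C \<in> ?Cs" "A = closure C" by blast
      then have "interior A \<subseteq> free_region E"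
        using interior_closure_component[OF E C(1)] in_components_subset by blast
      then show "P \<inter> interior A = {}"
        using vertices_in_drawing[OF E] by (auto simp: free_region_def)
    qed
  qed
  have "(\<Union>A\<in>?D. interior A) = \<Union>?Cs"
    using interior_closure_component[OF E] by simp
  then have "drawing (skeleton_edges ?D) = convex hull P - free_region E"
    using drawing_skeleton[OF D] by simp
  also have "\<dots> = drawing E"
    using drawing_subset_hull[OF ES] hull_boundary_subset_drawing[OF convex_graphD(2)[OF E]]
    by (auto simp: free_region_def)
  finally have eq: "drawing (skeleton_edges ?D) = drawing E" .
  have sub: "A \<subseteq> B" if AB: "edge_set P A" "edge_set P B" "drawing A = drawing B" for A B
  proof
    fix e assume e: "e \<in> A"
    obtain a b where ab: "a \<in> P" "b \<in> P" "a \<noteq> b" "e = {a, b}" by (rule edge_setE[OF AB(1) e])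
    have "convex hull e \<subseteq> drawing A" unfolding drawing_def using e by (rule UN_upper)
    then have "convex hull e \<subseteq> drawing B" unfolding AB(3) .
    then show "e \<in> B" using segment_in_drawing[OF ab(1-3) AB(2)] ab(4) by simp
  qed
  show "skeleton_edges ?D = E"
    using sub[OF edge_set_skeleton[OF D] ES eq] sub[OF ES edge_set_skeleton[OF D] eq[symmetric]] by blast
qed

end

section \<open>Contraction and deletion\<close>

text \<open>A segment from inside to outside is connected and so meets the frontier, which consists
  of the three sides.\<close>

lemma leaves_triangle:
  fixes a b c :: point
  assumes "y \<in> interior (convex hull {a, b, c})" "x \<notin> interior (convex hull {a, b, c})"
  obtains z where "z \<in> convex hull {x, y}"
    "z \<in> convex hull {a, b} \<or> z \<in> convex hull {b, c} \<or> z \<in> convex hull {a, c}"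
proof -
  let ?T = "interior (convex hull {a, b, c})"
  have xy: "x \<in> convex hull {x, y}" "y \<in> convex hull {x, y}" by (simp_all add: hull_inc)
  have "connected (convex hull {x, y})" by (simp add: convex_connected)
  moreover have "convex hull {x, y} \<inter> ?T \<noteq> {}" "convex hull {x, y} - ?T \<noteq> {}"
    using assms xy by blast+
  ultimately obtain z where z: "z \<in> convex hull {x, y}" "z \<in> frontier ?T"
    using connected_Int_frontier by blast
  have "z \<in> frontier (convex hull {a, b, c})"
    using z(2) frontier_interior_subset by blast
  then have "z \<in> closed_segment a b \<union> closed_segment b c \<union> closed_segment c a"
    by (subst (asm) frontier_of_triangle) simp_all
  then show thesis using that[OF z(1)] by (auto simp: segment_convex_hull insert_commute)
qed

lemma orient_hull_ge:
  assumes "z \<in> convex hull {x, y}" "k \<le> d * orient a b x" "k \<le> d * orient a b y"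
  shows "k \<le> d * orient a b z"
proof -
  obtain t where t: "0 \<le> t" "t \<le> 1" "z = (1 - t) *\<^sub>R x + t *\<^sub>R y"
    using assms(1) by (auto simp: segment_convex_hull[symmetric] in_segment)
  have "k = (1 - t) * k + t * k" by (simp add: algebra_simps)
  also have "\<dots> \<le> (1 - t) * (d * orient a b x) + t * (d * orient a b y)"
    using t assms by (intro add_mono mult_left_mono) auto
  also have "\<dots> = d * orient a b z" unfolding t(3) orient_segment by (simp add: algebra_simps)
  finally show ?thesis .
qed

context points
begin

lemma convex_graph_is_skeleton:
  assumes "convex_graph E"
  shows "is_skeleton_of_decomposition P (P, E)"
  unfolding is_skeleton_of_decomposition_def skeleton_graph_def
  using convex_graph_decomposition[OF assms]
  by (intro exI[of _ "closure ` components (free_region E)"]) simp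

section \<open>Triangles at an inner vertex of degree three\<close>

lemma cubic_vertexD:
  assumes E: "convex_graph E" and u: "u \<in> P" "\<not> u extreme_point_of convex hull P"
    and N: "neighbours E u = {a, b, c}"
  shows "u \<in> interior (convex hull {a, b, c})"
    "a \<in> P" "b \<in> P" "c \<in> P" "a \<noteq> u" "b \<noteq> u" "c \<noteq> u" "a \<noteq> b" "a \<noteq> c" "b \<noteq> c"
    "{u, a} \<in> E" "{u, b} \<in> E" "{u, c} \<in> E" "{u, x} \<in> E \<Longrightarrow> x = a \<or> x = b \<or> x = c"
proof -
  show *: "u \<in> interior (convex hull {a, b, c})" using convex_graphD(4)[OF E u] N by simp
  have "neighbours E u \<subseteq> P - {u}" by (rule neighbours_subset[OF convex_graphD(1)[OF E]])
  then show "a \<in> P" "b \<in> P" "c \<in> P" "a \<noteq> u" "b \<noteq> u" "c \<noteq> u" using N by auto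
  have "orient a b c \<noteq> 0" using * interior_triangle_empty_iff by blast
  then show "a \<noteq> b" "a \<noteq> c" "b \<noteq> c" by auto
  have "x \<in> neighbours E u \<longleftrightarrow> {u, x} \<in> E" for x by (simp add: neighbours_def insert_commute)
  then show "{u, a} \<in> E" "{u, b} \<in> E" "{u, c} \<in> E" "{u, x} \<in> E \<Longrightarrow> x = a \<or> x = b \<or> x = c"
    using N by auto
qed

text \<open>Prepares for the new edge \<open>{a, c}\<close>: an old edge crossing it can then not
  end inside the triangle.\<close>

lemma empty_triangle:
  assumes E: "convex_graph E" and u: "u \<in> P" "\<not> u extreme_point_of convex hull P"
    and N: "neighbours E u = {a, b, c}"
  shows "P \<inter> interior (convex hull {u, a, c}) = {}"
proof (rule ccontr)
  let ?T = "interior (convex hull {u, a, c})"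
  note cub = cubic_vertexD[OF E u N]
  assume ne: "P \<inter> ?T \<noteq> {}"
  \<comment> \<open>The factor \<open>d\<close> makes \<open>d * orient a c\<close> positive on the
    side of \<open>u\<close>, whatever the orientation.\<close>
  define d where "d = orient a c u"
  have d0: "d \<noteq> 0" using orient_nonzero cub u(1) by (simp add: d_def)
  text \<open>The vertex of the triangle farthest from \<open>ac\<close> has a neighbour still farther away.\<close>
  obtain p where p: "p \<in> P \<inter> ?T" "\<And>q. q \<in> P \<inter> ?T \<Longrightarrow> d * orient a c q \<le> d * orient a c p"
    using finite_maximum[of "P \<inter> ?T" "\<lambda>q. d * orient a c q"] ne finite_P by auto
  have pT: "p \<in> ?T" and pP: "p \<in> P" using p(1) by auto
  have pos: "d * orient a c p > 0"
  proof -
    have "orient u a c = d" "orient u a p + orient a c p + orient c u p = d"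
      by (simp_all add: d_def orient_def algebra_simps)
    then show ?thesis
      using pT by (auto simp: interior_triangle_iff zero_less_mult_iff)
  qed
  have ac0: "p \<noteq> u" "p \<noteq> a" "p \<noteq> c" using pT by (auto simp: interior_triangle_iff)
  have "convex hull {u, a, c} \<subseteq> convex hull P" using u(1) cub by (intro hull_mono) auto
  then have "p \<in> interior (convex hull P)" using pT interior_mono by blast
  then have "\<not> p extreme_point_of convex hull P" using interior_iff_nonextreme[OF pP] by simp
  then have "p \<in> interior (convex hull (neighbours E p))" by (rule convex_graphD(4)[OF E pP])
  moreover have "d *\<^sub>R normal a c \<noteq> 0" using d0 normal_nonzero cub by simp
  ultimately obtain q where q: "q \<in> neighbours E p" "(d *\<^sub>R normal a c) \<bullet> (q - p) > 0"
    using not_in_interior_convex_hull_iff[of p "neighbours E p"] by (meson not_le)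
  have qE: "{q, p} \<in> E" using q(1) by (simp add: neighbours_def)
  have qP: "q \<in> P" using q(1) neighbours_subset[OF convex_graphD(1)[OF E]] by blast
  have lt: "d * orient a c p < d * orient a c q"
  proof -
    have "0 < d * (orient a c q - orient a c p)" using q(2) unfolding orient_diff_inner by simp
    then show ?thesis by (simp add: right_diff_distrib)
  qed
  then have "q \<notin> ?T" using p(2)[of q] qP by force
  then obtain z where z: "z \<in> convex hull {q, p}"
    "z \<in> convex hull {u, a} \<or> z \<in> convex hull {a, c} \<or> z \<in> convex hull {u, c}"
    by (rule leaves_triangle[OF pT])
  have zpos: "d * orient a c z > 0"
    using orient_hull_ge[OF z(1), of "d * orient a c p" d a c] lt pos by linarith
  then have "z \<notin> convex hull {a, c}" using orient_on_segment by force
  then obtain x where x: "x = a \<or> x = c" "z \<in> convex hull {u, x}" using z(2) by blast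
  have "{u, x} \<in> E" using x(1) cub by blast
  moreover have "{q, p} \<noteq> {u, x}" using ac0 x(1) by (auto simp: doubleton_eq_iff)
  ultimately have "z \<in> {q, p}" "z \<in> {u, x}"
    using convex_graphD(3)[OF E qE _ _ z(1) x(2)] by blast+
  moreover have "z \<noteq> x" using zpos x(1) by auto
  \<comment> \<open>The edge \<open>{q, p}\<close> can leave the triangle neither through
    \<open>a c\<close>, from which it recedes, nor across \<open>u a\<close> or \<open>u c\<close>,
    so it ends at \<open>u\<close>. Then \<open>p\<close> is the third neighbour \<open>b\<close>,
    and \<open>u\<close> would be interior to a triangle of which it is a corner.\<close>
  ultimately have "z = u" "q = u" using ac0 by auto
  then have "{u, p} \<in> E" using qE by simp
  then have "p = b" using cub(14) ac0 by blast
  then have "convex hull {a, b, c} \<subseteq> convex hull {u, a, c}"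
    using pT interior_subset[of "convex hull {u, a, c}"]
    by (intro hull_minimal) (auto simp: hull_inc)
  then have "u \<in> ?T" using cub(1) interior_mono by blast
  then show False by (simp add: interior_triangle_iff)
qed

text \<open>A crossing edge enters the triangle \<open>u a c\<close> at \<open>m\<close> and heads
  for its end on the side of \<open>u\<close>. By \<open>empty_triangle\<close> it must leave again;
  not through \<open>a c\<close>, as it moves away from that line, hence through \<open>u a\<close>
  or \<open>u c\<close>, which are edges that it cannot cross.\<close>

lemma diagonal_crossing_free:
  assumes E: "convex_graph E" and u: "u \<in> P" "\<not> u extreme_point_of convex hull P"
    and N: "neighbours E u = {a, b, c}"
    and e: "e \<in> E" "u \<notin> e" "e \<noteq> {a, c}" and m: "m \<in> convex hull e" "m \<in> convex hull {a, c}"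
  shows "m \<in> e \<and> m \<in> {a, c}"
proof -
  let ?T = "interior (convex hull {u, a, c})"
  note cub = cubic_vertexD[OF E u N]
  obtain p q where pq: "p \<in> P" "q \<in> P" "p \<noteq> q" "e = {p, q}"
    by (rule edge_setE[OF convex_graphD(1)[OF E] e(1)])
  show ?thesis
  proof (cases "m \<in> P")
    case True
    then show ?thesis using on_segmentD[of m p q] on_segmentD[of m a c] m pq cub by auto
  next
    case False
    define d where "d = orient a c u"
    have d0: "d \<noteq> 0" using orient_nonzero cub u(1) by (simp add: d_def)
    have "orient a c p * orient a c q < 0"
      using crossing_sides[OF cub(2,4) pq(1,2) cub(9) pq(3) _ m(2) _ False] e(3) m(1) unfolding pq(4) by blast
    then have "\<exists>x\<in>e. d * orient a c x > 0"
      using d0 pq(4) by (auto simp: zero_less_mult_iff mult_less_0_iff)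
    then obtain x where x: "x \<in> e" "d * orient a c x > 0" by blast
    have "m \<in> open_segment a c" using m(2) False cub in_open_segment_iff[of m a c] by auto
    then obtain t where t: "t > 0" "t \<le> 1" "(1 - t) *\<^sub>R m + t *\<^sub>R x \<in> interior (convex hull {a, c, u})"
      using triangle_entered[of m a c u x] x(2) unfolding d_def by (meson order_refl)
    define y where "y = (1 - t) *\<^sub>R m + t *\<^sub>R x"
    have yT: "y \<in> ?T" using t(3) by (simp add: y_def insert_commute)
    have "x \<in> P" using x(1) pq by blast
    then have "x \<notin> ?T" using empty_triangle[OF E u N] by blast
    then obtain z where z: "z \<in> convex hull {x, y}"
      "z \<in> convex hull {u, a} \<or> z \<in> convex hull {a, c} \<or> z \<in> convex hull {u, c}"
      by (rule leaves_triangle[OF yT])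
    have xe: "x \<in> convex hull e" by (rule hull_inc[OF x(1)])
    have "y \<in> convex hull e"
      unfolding y_def using m(1) xe t by (intro convexD[OF convex_convex_hull]) auto
    then have "convex hull {x, y} \<subseteq> convex hull e" using xe by (intro hull_minimal) auto
    then have ze: "z \<in> convex hull e" using z(1) by blast
    have "orient a c y = t * orient a c x"
      unfolding y_def orient_segment using orient_on_segment[OF m(2)] by simp
    then have "d * orient a c y = t * (d * orient a c x)" by simp
    then have "d * orient a c y > 0" using t(1) x(2) by (simp only: mult_pos_pos)
    then have zpos: "d * orient a c z > 0"
      using orient_hull_ge[OF z(1), of "min (d * orient a c x) (d * orient a c y)" d a c] x(2) by simp
    then have "z \<notin> convex hull {a, c}" using orient_on_segment by force
    then obtain v where v: "v = a \<or> v = c" "z \<in> convex hull {u, v}" using z(2) by blast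
    have "{u, v} \<in> E" using v(1) cub by blast
    moreover have "e \<noteq> {u, v}" using e(2) by blast
    ultimately have "z \<in> e" "z \<in> {u, v}" using convex_graphD(3)[OF E e(1) _ _ ze v(2)] by blast+
    then have "z = v" using e(2) by blast
    then show ?thesis using zpos v(1) by auto
  qed
qed

text \<open>Contracting \<open>uc\<close> from \<open>u\<close> replaces the neighbour \<open>u\<close> of \<open>a\<close> by \<open>c\<close>.\<close>

definition blocked :: "point set set \<Rightarrow> point \<Rightarrow> point \<Rightarrow> point \<Rightarrow> bool" where
  "blocked E u a c \<longleftrightarrow> \<not> a extreme_point_of convex hull P \<and>
     a \<notin> interior (convex hull (insert c (neighbours E a - {u})))"

text \<open>The hull is generated by its extreme points, and these all remain.\<close>

lemma hull_remove:
  assumes "\<not> u extreme_point_of convex hull P"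
  shows "convex hull (P - {u}) = convex hull P"
proof
  have "convex hull P = convex hull {x. x extreme_point_of convex hull P}"
    by (rule Krein_Milman_Minkowski) (simp_all add: finite_P finite_imp_compact_convex_hull)
  also have "\<dots> \<subseteq> convex hull (P - {u})"
    using assms extreme_point_of_convex_hull by (intro hull_mono) blast
  finally show "convex hull P \<subseteq> convex hull (P - {u})" .
qed (intro hull_mono, blast)

lemma points_remove:
  assumes E: "convex_graph E" and u: "u \<in> P" "\<not> u extreme_point_of convex hull P"
    and N: "neighbours E u = {a, b, c}"
  shows "points (P - {u})"
proof
  note cub = cubic_vertexD[OF E u N]
  show "finite (P - {u})" using finite_P by simp
  have "card {a, b, c} = 3" using cub by auto
  then show "card (P - {u}) \<ge> 3"
    using card_mono[of "P - {u}" "{a, b, c}"] finite_P cub by auto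
  show "general_position (P - {u})" using gp by (auto simp: general_position_def)
qed

text \<open>Only the neighbourhoods of \<open>a\<close>, \<open>b\<close> and \<open>c\<close>
  change. The hypotheses handle \<open>a\<close> and \<open>b\<close>, while \<open>c\<close> always
  remains surrounded.\<close>

lemma convex_graph_contract:
  assumes E: "convex_graph E" and u: "u \<in> P" "\<not> u extreme_point_of convex hull P"
    and N: "neighbours E u = {a, b, c}" and nb: "\<not> blocked E u a c" "\<not> blocked E u b c"
  shows "points.convex_graph (P - {u}) ({e \<in> E. u \<notin> e} \<union> {{a, c}, {b, c}})"
proof -
  note cub = cubic_vertexD[OF E u N]
  interpret Q: points "P - {u}" by (rule points_remove[OF E u N])
  note hull = hull_remove[OF u(2)]
  let ?E = "{e \<in> E. u \<notin> e} \<union> {{a, c}, {b, c}}"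
  have ES: "edge_set P E" using convex_graphD(1)[OF E] .
  \<comment> \<open>The lemma on diagonals speaks of \<open>{a, c}\<close>; exchanging
    \<open>a\<close> and \<open>b\<close> gives it for \<open>{b, c}\<close>.\<close>
  have N': "neighbours E u = {b, a, c}" using N by auto
  have new: "m \<in> e \<and> m \<in> f"
    if "e \<in> E" "u \<notin> e" "f = {a, c} \<or> f = {b, c}" "e \<noteq> f" "m \<in> convex hull e" "m \<in> convex hull f" for e f m
    using that diagonal_crossing_free[OF E u N, of e m] diagonal_crossing_free[OF E u N', of e m] by blast
  have acbc: "m = c" if m: "m \<in> convex hull {a, c}" "m \<in> convex hull {b, c}" for m
  proof (rule ccontr)
    assume "m \<noteq> c"
    moreover have "c \<in> convex hull {a, c}" by (rule hull_inc) simp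
    ultimately have "orient b c a = 0"
      using orient_line_unique(1)[OF _ m(1), of c b c] orient_on_segment[OF m(2)] by simp
    then show False using orient_nonzero cub by metis
  qed
  have "edge_set (P - {u}) ?E"
    unfolding edge_set_def
  proof
    fix e assume "e \<in> ?E"
    then consider "e \<in> E" "u \<notin> e" | "e = {a, c}" | "e = {b, c}" by blast
    then show "\<exists>x\<in>P - {u}. \<exists>y\<in>P - {u}. x \<noteq> y \<and> e = {x, y}"
    proof cases
      case 1
      obtain x y where "x \<in> P" "y \<in> P" "x \<noteq> y" "e = {x, y}" by (rule edge_setE[OF ES 1(1)])
      then show ?thesis using 1(2) by blast
    qed (use cub in blast)+
  qed
  moreover have "polygon_sides (convex hull (P - {u})) \<subseteq> ?E"
  proof
    fix e assume "e \<in> polygon_sides (convex hull (P - {u}))"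
    then have e: "e \<in> polygon_sides (convex hull P)" using hull by simp
    then obtain x y where "e = {x, y}" "x extreme_point_of convex hull P" "y extreme_point_of convex hull P"
      by (rule polygon_sideE)
    then have "u \<notin> e" using u(2) by blast
    then show "e \<in> ?E" using e convex_graphD(2)[OF E] by blast
  qed
  moreover have "convex hull e \<inter> convex hull f \<subseteq> e \<inter> f" if asm: "e \<in> ?E" "f \<in> ?E" "e \<noteq> f" for e f
  proof
    fix m assume m: "m \<in> convex hull e \<inter> convex hull f"
    have ef: "(e \<in> E \<and> u \<notin> e) \<or> e = {a, c} \<or> e = {b, c}" "(f \<in> E \<and> u \<notin> f) \<or> f = {a, c} \<or> f = {b, c}"
      using asm(1,2) by auto
    consider "e \<in> E" "f \<in> E" | "e \<in> E" "u \<notin> e" "f = {a, c} \<or> f = {b, c}"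
      | "f \<in> E" "u \<notin> f" "e = {a, c} \<or> e = {b, c}" | "e = {a, c}" "f = {b, c}" | "f = {a, c}" "e = {b, c}"
      using ef asm(3) by metis
    then show "m \<in> e \<inter> f"
    proof cases
      case 1
      then show ?thesis using convex_graphD(3)[OF E 1 asm(3)] m by blast
    next
      case 2
      then show ?thesis using new[OF 2 asm(3)] m by blast
    next
      case 3
      then show ?thesis using new[OF 3 asm(3)[symmetric]] m by blast
    qed (use acbc m in blast)+
  qed
  moreover have "v \<in> interior (convex hull (neighbours ?E v))"
    if v: "v \<in> P - {u}" "\<not> v extreme_point_of convex hull (P - {u})" for v
  proof -
    have vn: "\<not> v extreme_point_of convex hull P" "v \<in> P" using v hull by auto
    have sur: "v \<in> interior (convex hull (neighbours E v))" by (rule convex_graphD(4)[OF E vn(2,1)])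
    have mono: "v \<in> interior (convex hull (neighbours ?E v))"
      if "v \<in> interior (convex hull X)" "X \<subseteq> neighbours ?E v" for X
      using that interior_mono[OF hull_mono] by blast
    have old: "neighbours E v - {u} \<subseteq> neighbours ?E v" using v(1) by (auto simp: neighbours_def)
    consider "v = a" | "v = b" | "v = c" | "v \<noteq> a" "v \<noteq> b" "v \<noteq> c" by blast
    then show ?thesis
    proof cases
      case 1
      have "insert c (neighbours E a - {u}) \<subseteq> neighbours ?E a"
        using old 1 by (auto simp: neighbours_def insert_commute)
      then show ?thesis using nb(1) vn(1) mono 1 unfolding blocked_def by blast
    next
      case 2
      have "insert c (neighbours E b - {u}) \<subseteq> neighbours ?E b"
        using old 2 by (auto simp: neighbours_def insert_commute)
      then show ?thesis using nb(2) vn(1) mono 2 unfolding blocked_def by blast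
    next
      case 3
      \<comment> \<open>\<open>c\<close> loses \<open>u\<close> but has \<open>a\<close> and
        \<open>b\<close> as neighbours: a closed half-plane bounded by a line through
        \<open>c\<close> and containing all new neighbours contains the triangle
        \<open>a b c\<close>, hence \<open>u\<close>, hence all old neighbours.\<close>
      show ?thesis
      proof (rule ccontr)
        assume "\<not> ?thesis"
        then obtain w where w: "w \<noteq> 0" "\<And>x. x \<in> neighbours ?E v \<Longrightarrow> w \<bullet> (x - v) \<le> 0"
          by (auto simp: not_in_interior_convex_hull_iff)
        have "a \<in> neighbours ?E v" "b \<in> neighbours ?E v" using 3 by (auto simp: neighbours_def)
        then have "{a, b, c} \<subseteq> {x. w \<bullet> x \<le> w \<bullet> v}" using w(2) 3 by (auto simp: inner_diff_right)
        then have "convex hull {a, b, c} \<subseteq> {x. w \<bullet> x \<le> w \<bullet> v}" by (intro hull_minimal convex_halfspace_le)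
        then have "w \<bullet> (u - v) \<le> 0" using cub(1) interior_subset by (auto simp: inner_diff_right)
        then have "w \<bullet> (x - v) \<le> 0" if "x \<in> neighbours E v" for x
          using w(2)[of x] old that by (cases "x = u") auto
        then show False using sur w(1) not_in_interior_convex_hull_iff by blast
      qed
    next
      case 4
      then have "u \<notin> neighbours E v" using cub(14)[of v] by (auto simp: neighbours_def)
      then show ?thesis using mono[OF sur] old by blast
    qed
  qed
  ultimately show ?thesis unfolding Q.convex_graph_def by blast
qed

lemma contractible_if_not_blocked:
  assumes D: "convex_decomposition P D" and u: "u \<in> P" "\<not> u extreme_point_of convex hull P"
    and N: "neighbours (skeleton_edges D) u = {a, b, c}"
    and nb: "\<not> blocked (skeleton_edges D) u a c" "\<not> blocked (skeleton_edges D) u b c"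
  shows "contractible_from_to P D u c"
proof -
  let ?E = "skeleton_edges D"
  let ?E' = "{e \<in> ?E. u \<notin> e} \<union> {{a, c}, {b, c}}"
  have E: "convex_graph ?E" by (rule convex_graph_skeleton[OF D])
  note cub = cubic_vertexD[OF E u N]
  interpret Q: points "P - {u}" by (rule points_remove[OF E u N])
  have "Q.convex_graph ?E'" by (rule convex_graph_contract[OF E u N nb])
  then have "is_skeleton_of_decomposition (P - {u}) (P - {u}, ?E')"
    by (rule Q.convex_graph_is_skeleton)
  moreover have "contract_edge (skeleton_graph P D) u c = (P - {u}, ?E')"
  proof -
    have X: "{x. x \<noteq> c \<and> {x, u} \<in> ?E} = {a, b}"
      using N cub(9,10) unfolding neighbours_def by blast
    have "e \<in> {{x, u} |x. x \<in> {a, b}} \<union> {{u, c}}" if e: "e \<in> ?E" "u \<in> e" for e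
    proof -
      obtain x y where "e = {x, y}" by (rule edge_setE[OF edge_set_skeleton[OF D] e(1)])
      then obtain z where "e = {u, z}" using e(2) by blast
      then show ?thesis using cub(14)[of z] e(1) by (auto simp: insert_commute)
    qed
    then have "?E - ({{x, u} |x. x \<in> {a, b}} \<union> {{u, c}}) = {e \<in> ?E. u \<notin> e}" by auto
    moreover have "{{x, c} |x. x \<in> {a, b}} = {{a, c}, {b, c}}" by auto
    ultimately show ?thesis
      by (simp only: contract_edge_def skeleton_graph_def fst_conv snd_conv X Let_def)
  qed
  moreover have "interior_edge P D {u, c}"
    using cub(13) hull_side_ends(1)[of u c] u(2) unfolding interior_edge_def by blast
  ultimately show ?thesis unfolding contractible_from_to_def by simp
qed

section \<open>Deletion of an edge\<close>

definition needed :: "point set set \<Rightarrow> point \<Rightarrow> point \<Rightarrow> bool" where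
  "needed E u v \<longleftrightarrow> \<not> u extreme_point_of convex hull P \<and>
     u \<notin> interior (convex hull (neighbours E u - {v}))"

lemma convex_graph_delete:
  assumes E: "convex_graph E" and uv: "{u, v} \<notin> polygon_sides (convex hull P)"
    and "\<not> needed E u v" "\<not> needed E v u"
  shows "convex_graph (E - {{u, v}})"
  unfolding convex_graph_def
proof (intro conjI ballI impI)
  show "edge_set P (E - {{u, v}})" using convex_graphD(1)[OF E] by (auto simp: edge_set_def)
  show "polygon_sides (convex hull P) \<subseteq> E - {{u, v}}" using convex_graphD(2)[OF E] uv by blast
  show "convex hull e \<inter> convex hull f \<subseteq> e \<inter> f"
    if "e \<in> E - {{u, v}}" "f \<in> E - {{u, v}}" "e \<noteq> f" for e f
    using convex_graphD(3)[OF E] that by blast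
  fix x assume x: "x \<in> P" "\<not> x extreme_point_of convex hull P"
  have "neighbours (E - {{u, v}}) x =
    (if x = u then neighbours E u - {v} else if x = v then neighbours E v - {u} else neighbours E x)"
    by (auto simp: neighbours_def doubleton_eq_iff)
  then show "x \<in> interior (convex hull (neighbours (E - {{u, v}}) x))"
    using convex_graphD(4)[OF E x] assms(3,4) x(2) unfolding needed_def by auto
qed

lemma deletable_if_not_needed:
  assumes D: "convex_decomposition P D" and int: "interior_edge P D {u, v}"
    and nn: "\<not> needed (skeleton_edges D) u v" "\<not> needed (skeleton_edges D) v u"
  shows "deletable P D {u, v}"
proof -
  have "convex_graph (skeleton_edges D - {{u, v}})"
    using convex_graph_delete[OF convex_graph_skeleton[OF D] _ nn] int by (simp add: interior_edge_def)
  then have "is_skeleton_of_decomposition P (P, skeleton_edges D - {{u, v}})"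
    by (rule convex_graph_is_skeleton)
  then show ?thesis
    using int by (simp add: deletable_def delete_edge_def skeleton_graph_def)
qed

end

section \<open>Double counting\<close>

text \<open>The values of \<open>orient _ d u\<close> at \<open>a\<close>, \<open>b\<close>,
  \<open>c\<close> do not all have the same sign, so in one of the two cyclic orders they change
  from negative to positive somewhere; those two corners form a triangle with \<open>d\<close>
  around \<open>u\<close>.\<close>

lemma triangle_exchange:
  assumes u: "u \<in> interior (convex hull {a, b, c})"
    and d: "orient a d u \<noteq> 0" "orient b d u \<noteq> 0" "orient c d u \<noteq> 0"
  shows "u \<in> interior (convex hull {b, c, d}) \<or> u \<in> interior (convex hull {c, a, d})
    \<or> u \<in> interior (convex hull {a, b, d})"
proof -
  \<comment> \<open>\<open>orient _ d u\<close> is affine and vanishes at \<open>u\<close>; this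
    expands it there with the unnormalised barycentric coordinates of \<open>u\<close>.\<close>
  have id: "orient b c u * orient a d u + orient c a u * orient b d u + orient a b u * orient c d u = 0"
    by (simp add: orient_def algebra_simps)
  have sw: "orient d a u = - orient a d u" "orient d b u = - orient b d u" "orient d c u = - orient c d u"
    by (rule orient_swap)+
  show ?thesis
    using u unfolding interior_triangle_iff sw
  proof (elim disjE conjE)
    assume p: "orient a b u > 0" "orient b c u > 0" "orient c a u > 0"
    have "\<not> (orient a d u > 0 \<and> orient b d u > 0 \<and> orient c d u > 0)"
      using id p by (smt (verit) mult_pos_pos)
    moreover have "\<not> (orient a d u < 0 \<and> orient b d u < 0 \<and> orient c d u < 0)"
      using id p by (smt (verit) mult_pos_neg)
    ultimately show "((orient b c u > 0 \<and> orient c d u > 0 \<and> - orient b d u > 0) \<or>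
        (orient b c u < 0 \<and> orient c d u < 0 \<and> - orient b d u < 0)) \<or>
      ((orient c a u > 0 \<and> orient a d u > 0 \<and> - orient c d u > 0) \<or>
        (orient c a u < 0 \<and> orient a d u < 0 \<and> - orient c d u < 0)) \<or>
      ((orient a b u > 0 \<and> orient b d u > 0 \<and> - orient a d u > 0) \<or>
        (orient a b u < 0 \<and> orient b d u < 0 \<and> - orient a d u < 0))"
      using p d by (auto simp: linorder_neq_iff)
  next
    assume p: "orient a b u < 0" "orient b c u < 0" "orient c a u < 0"
    have "\<not> (orient a d u > 0 \<and> orient b d u > 0 \<and> orient c d u > 0)"
      using id p by (smt (verit) mult_neg_pos)
    moreover have "\<not> (orient a d u < 0 \<and> orient b d u < 0 \<and> orient c d u < 0)"
      using id p by (smt (verit) mult_neg_neg)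
    ultimately show "((orient b c u > 0 \<and> orient c d u > 0 \<and> - orient b d u > 0) \<or>
        (orient b c u < 0 \<and> orient c d u < 0 \<and> - orient b d u < 0)) \<or>
      ((orient c a u > 0 \<and> orient a d u > 0 \<and> - orient c d u > 0) \<or>
        (orient c a u < 0 \<and> orient a d u < 0 \<and> - orient c d u < 0)) \<or>
      ((orient a b u > 0 \<and> orient b d u > 0 \<and> - orient a d u > 0) \<or>
        (orient a b u < 0 \<and> orient b d u < 0 \<and> - orient a d u < 0))"
      using p d by (auto simp: linorder_neq_iff)
  qed
qed

lemma opposite_sides:
  assumes "u \<in> interior (convex hull {v, b, c})"
  shows "orient u v b * orient u v c < 0"
proof -
  have "orient v b u = orient u v b" "orient c v u = - orient u v c"
    by (simp_all add: orient_def algebra_simps)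
  then show ?thesis using assms by (auto simp: interior_triangle_iff mult_less_0_iff)
qed

text \<open>The sign bookkeeping of \<open>two_triangles\<close>, with areas as variables:
  \<open>p\<close>, \<open>q\<close> are those of \<open>u v y\<close>, \<open>u v c\<close>, and
  \<open>s\<^sub>1\<close>, \<open>s\<^sub>2\<close> those of \<open>v c y\<close>,
  \<open>u y c\<close>. As \<open>q - p\<close> is negative, one of \<open>s\<^sub>1\<close>,
  \<open>s\<^sub>2\<close> is: the first case secures \<open>v\<close>, the second
  \<open>u\<close>.\<close>

lemma two_triangles_signs:
  fixes p q yz zu bc vb s\<^sub>1 s\<^sub>2 zc yb :: real
  assumes "p > 0" "q < 0" "yz < 0" "zu < 0" "bc > 0" "vb > 0"
    and sum: "s\<^sub>1 + s\<^sub>2 = q - p"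
    and id1: "yz * q + zc * p + s\<^sub>1 * zu = 0" and id2: "s\<^sub>2 * vb - bc * p - yb * q = 0"
  shows "(s\<^sub>1 < 0 \<and> zc < 0) \<or> (s\<^sub>2 < 0 \<and> yb > 0)"
proof -
  consider "s\<^sub>1 < 0" | "s\<^sub>2 < 0" using sum assms(1,2) by linarith
  then show ?thesis
  proof cases
    case 1
    have "yz * q > 0" "s\<^sub>1 * zu > 0" using assms 1 by (simp_all add: mult_neg_neg)
    then have "zc * p < 0" using id1 by linarith
    then show ?thesis using 1 assms(1) by (simp add: mult_less_0_iff)
  next
    case 2
    have "s\<^sub>2 * vb < 0" "bc * p > 0" using assms 2 by (simp_all add: mult_neg_pos)
    then have "yb * q < 0" using id2 by linarith
    then show ?thesis using 2 assms(2) by (simp add: mult_less_0_iff)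
  qed
qed

text \<open>If both memberships failed, the line \<open>cy\<close> would meet the line \<open>uv\<close> beyond \<open>u\<close> and also
  beyond \<open>v\<close>.\<close>

lemma two_triangles:
  assumes v: "v \<in> interior (convex hull {u, y, z})" and u: "u \<in> interior (convex hull {v, b, c})"
    and cy: "orient u v c * orient u v y < 0"
  shows "v \<in> interior (convex hull {c, y, z}) \<or> u \<in> interior (convex hull {y, b, c})"
proof -
  let ?p = "orient u v y" and ?q = "orient u v c"
  \<comment> \<open>\<open>sum\<close> computes the signed area of the quadrilateral
    \<open>u c v y\<close> by cutting along either diagonal. \<open>id1\<close> and
    \<open>id2\<close> are Grassmann-Pluecker relations between four vectors based at
    \<open>v\<close> and at \<open>u\<close>.\<close>
  have sum: "orient v c y + orient u y c = ?q - ?p"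
    and id1: "orient y z v * ?q + orient z c v * ?p + orient v c y * orient z u v = 0"
    and id2: "orient u y c * orient v b u - orient b c u * ?p - orient y b u * ?q = 0"
    by (simp_all add: orient_def algebra_simps)
  have eqs: "orient u y v = - ?p" "orient c v u = - ?q" "orient c y v = orient v c y"
    "orient c y u = - orient u y c"
    by (simp_all add: orient_def algebra_simps)
  consider "?p > 0" "?q < 0" | "?p < 0" "?q > 0" using cy by (auto simp: mult_less_0_iff)
  then show ?thesis
  proof cases
    case 1
    have "orient y z v < 0" "orient z u v < 0" "orient b c u > 0" "orient v b u > 0"
      using u v 1 unfolding interior_triangle_iff eqs by linarith+
    note two_triangles_signs[OF 1 this sum id1 id2]
    then show ?thesis
      unfolding interior_triangle_iff eqs using \<open>orient y z v < 0\<close> \<open>orient b c u > 0\<close> by linarith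
  next
    case 2
    have s: "- orient y z v < 0" "- orient z u v < 0" "- orient b c u > 0" "- orient v b u > 0"
      using u v 2 unfolding interior_triangle_iff eqs by linarith+
    \<comment> \<open>Mirror image of the first case: all areas change sign, which leaves the
      quadratic identities intact.\<close>
    have "(- orient v c y < 0 \<and> - orient z c v < 0) \<or> (- orient u y c < 0 \<and> - orient y b u > 0)"
      by (rule two_triangles_signs[OF _ _ s, of "- ?p" "- ?q"]) (use 2 sum id1 id2 in simp_all)
    then show ?thesis
      unfolding interior_triangle_iff eqs using s by linarith
  qed
qed

lemma card_filter_pair:
  "a \<noteq> b \<Longrightarrow> card {x \<in> {a, b}. Q x} = of_bool (Q a) + of_bool (Q b)"
proof -
  assume "a \<noteq> b"
  moreover have "{x \<in> {a, b}. Q x} = (if Q a then {a} else {}) \<union> (if Q b then {b} else {})" by auto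
  ultimately show ?thesis by auto
qed

context points
begin

text \<open>Caratheodory gives at most three points. By general position \<open>u\<close> lies on no
  segment between them, so there are exactly three and \<open>u\<close> is not on the frontier of
  their triangle.\<close>

lemma surrounding_triangle:
  assumes u: "u \<in> P" and N: "N \<subseteq> P - {u}" and "u \<in> interior (convex hull N)"
  obtains a b c where "{a, b, c} \<subseteq> N" "u \<in> interior (convex hull {a, b, c})"
proof -
  have "u \<in> convex hull N" using assms(3) interior_subset by blast
  then obtain S where S: "finite S" "S \<subseteq> N" "card S \<le> 3" "u \<in> convex hull S"
    unfolding caratheodory[of N] by auto
  have uS: "x \<noteq> u" "x \<in> P" if "x \<in> S" for x using that S(2) N by blast+
  have off: "u \<notin> convex hull {x, y}" if "x \<in> S" "y \<in> S" for x y
    using on_segmentD[of u x y] uS[of x] uS[of y] that u by metis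
  have "card S \<noteq> 0" using S(1,4) by auto
  moreover have "card S \<noteq> 1" using off S(4) by (auto simp: card_1_singleton_iff)
  moreover have "card S \<noteq> 2" using off S(4) by (auto simp: card_2_iff)
  ultimately have "card S = 3" using S(3) by linarith
  then obtain a b c where abc: "S = {a, b, c}" by (auto simp: card_3_iff)
  have "u \<notin> frontier (convex hull {a, b, c})"
    using off[of a b] off[of b c] off[of c a] unfolding abc
    by (subst frontier_of_triangle) (auto simp: segment_convex_hull)
  moreover have "u \<in> closure (convex hull {a, b, c})" using S(4) abc closure_subset by blast
  ultimately have "u \<in> interior (convex hull {a, b, c})" by (simp add: frontier_def)
  then show thesis using that S(2) abc by blast
qed

text \<open>A needed edge must end at a corner of every triangle of neighbours around
  \<open>u\<close>. Besides \<open>a b c\<close> there is a second such triangle, with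
  \<open>d\<close> in place of some corner \<open>x\<close>, so at most the two common corners
  remain.\<close>

lemma card_needed_le_2:
  assumes E: "convex_graph E" and u: "u \<in> P" "\<not> u extreme_point_of convex hull P"
    and card: "card (neighbours E u) \<ge> 4"
  shows "card {v \<in> neighbours E u. needed E u v} \<le> 2"
proof -
  let ?N = "neighbours E u"
  have N: "?N \<subseteq> P - {u}" by (rule neighbours_subset[OF convex_graphD(1)[OF E]])
  obtain a b c where abc: "{a, b, c} \<subseteq> ?N" "u \<in> interior (convex hull {a, b, c})"
    by (rule surrounding_triangle[OF u(1) N convex_graphD(4)[OF E u]])
  have "card {a, b, c} \<le> 3" by (simp add: card_insert_if)
  then have "?N \<noteq> {a, b, c}" using card by auto
  then obtain d where d: "d \<in> ?N" "d \<notin> {a, b, c}" using abc(1) by blast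
  have "orient x d u \<noteq> 0" if "x \<in> {a, b, c}" for x
    using orient_nonzero[of x d u] that d abc(1) N u(1) by blast
  then have "\<exists>x\<in>{a, b, c}. u \<in> interior (convex hull ({a, b, c, d} - {x}))"
  proof -
    have "a \<noteq> b" "a \<noteq> c" "b \<noteq> c" using abc(2) interior_triangle_empty_iff[of a b c] by auto
    then have "{a, b, c, d} - {a} = {b, c, d}" "{a, b, c, d} - {b} = {c, a, d}" "{a, b, c, d} - {c} = {a, b, d}"
      using d(2) by auto
    moreover have "u \<in> interior (convex hull {b, c, d}) \<or> u \<in> interior (convex hull {c, a, d})
      \<or> u \<in> interior (convex hull {a, b, d})"
      by (rule triangle_exchange[OF abc(2)])
        (use \<open>\<And>x. x \<in> {a, b, c} \<Longrightarrow> orient x d u \<noteq> 0\<close> in auto)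
    ultimately show ?thesis by auto
  qed
  then obtain x where x: "x \<in> {a, b, c}" "u \<in> interior (convex hull ({a, b, c, d} - {x}))" by blast
  have "{v \<in> ?N. needed E u v} \<subseteq> {a, b, c} - {x}"
  proof
    fix v assume v: "v \<in> {v \<in> ?N. needed E u v}"
    then have *: "u \<notin> interior (convex hull X)" if "X \<subseteq> ?N - {v}" for X
      using interior_mono[OF hull_mono[OF that]] by (auto simp: needed_def)
    have "v \<in> {a, b, c}" using *[of "{a, b, c}"] abc by blast
    moreover have "v \<noteq> x" using *[of "{a, b, c, d} - {x}"] x(2) abc(1) d(1) by blast
    ultimately show "v \<in> {a, b, c} - {x}" by blast
  qed
  then have "card {v \<in> ?N. needed E u v} \<le> card ({a, b, c} - {x})" by (intro card_mono) auto
  also have "\<dots> \<le> 2" using x(1) \<open>card {a, b, c} \<le> 3\<close> by (simp add: card_Diff_singleton)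
  finally show ?thesis .
qed

section \<open>Obstructions to contraction\<close>

definition cubic :: "point set set \<Rightarrow> point \<Rightarrow> bool" where
  "cubic E u \<longleftrightarrow> u \<in> P \<and> \<not> u extreme_point_of convex hull P \<and> card (neighbours E u) = 3"

text \<open>The targets \<open>x\<close> to which \<open>u\<close> cannot be contracted because of
  \<open>v\<close>. They are booked on the edge to the blocking neighbour \<open>v\<close>, not on
  the edge to \<open>x\<close>.\<close>

definition obstructions :: "point set set \<Rightarrow> point \<Rightarrow> point \<Rightarrow> point set" where
  "obstructions E u v = {x \<in> neighbours E u - {v}. cubic E u \<and> blocked E u v x}"

lemma cubicE:
  assumes "convex_graph E" "cubic E u" "{u, v} \<in> E"
  obtains b c where "neighbours E u = {v, b, c}" "v \<noteq> b" "v \<noteq> c" "b \<noteq> c"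
    "obstructions E u v = {x \<in> {b, c}. blocked E u v x}"
proof -
  have v: "v \<in> neighbours E u" using assms(3) by (simp add: neighbours_def insert_commute)
  then have "card (neighbours E u - {v}) = 2" using assms(2) by (simp add: cubic_def)
  then obtain b c where bc: "neighbours E u - {v} = {b, c}" "b \<noteq> c" by (auto simp: card_2_iff)
  then have "neighbours E u = {v, b, c}" "v \<noteq> b" "v \<noteq> c" using v by auto
  moreover have "obstructions E u v = {x \<in> {b, c}. blocked E u v x}"
    using assms(2) bc(1) by (simp add: obstructions_def)
  ultimately show thesis using that bc(2) by blast
qed

lemma card_obstructions_le_2:
  assumes "{u, v} \<in> E"
  shows "card (obstructions E u v) \<le> 2"
proof (cases "cubic E u")
  case True
  then have N: "card (neighbours E u) = 3" by (simp add: cubic_def)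
  have "v \<in> neighbours E u" using assms by (simp add: neighbours_def insert_commute)
  have "finite (neighbours E u)" using N card.infinite by fastforce
  then have "card (obstructions E u v) \<le> card (neighbours E u - {v})"
    unfolding obstructions_def by (intro card_mono) auto
  then show ?thesis using N \<open>v \<in> _\<close> by simp
qed (simp add: obstructions_def)

text \<open>If only one end is cubic, it has just two other neighbours as targets. If both are, each
  of \<open>b\<close>, \<open>c\<close> is paired with the one of \<open>y\<close>, \<open>z\<close>
  across the line \<open>u v\<close>, and \<open>two_triangles\<close> forbids that both members of
  a pair are obstructions.\<close>

lemma card_obstructions_sum:
  assumes E: "convex_graph E" and uv: "{u, v} \<in> E"
  shows "card (obstructions E u v) + card (obstructions E v u) \<le> 2"
proof (cases "cubic E u \<and> cubic E v")
  case False
  then have "obstructions E u v = {} \<or> obstructions E v u = {}" by (auto simp: obstructions_def)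
  then show ?thesis
    using card_obstructions_le_2[OF uv] card_obstructions_le_2[of v u E] uv by (auto simp: insert_commute)
next
  case True
  obtain b c where b: "neighbours E u = {v, b, c}" "v \<noteq> b" "v \<noteq> c" "b \<noteq> c"
    and ou: "obstructions E u v = {x \<in> {b, c}. blocked E u v x}"
    by (rule cubicE[OF E conjunct1[OF True] uv])
  have vu: "{v, u} \<in> E" using uv by (simp add: insert_commute)
  obtain y z where y: "neighbours E v = {u, y, z}" "u \<noteq> y" "u \<noteq> z" "y \<noteq> z"
    and ov: "obstructions E v u = {x \<in> {y, z}. blocked E v u x}"
    by (rule cubicE[OF E conjunct2[OF True] vu])
  have uI: "u \<in> interior (convex hull {v, b, c})" and vI: "v \<in> interior (convex hull {u, y, z})"
    using convex_graphD(4)[OF E, of u] convex_graphD(4)[OF E, of v] True b(1) y(1)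
    by (simp_all add: cubic_def)
  have cards: "card (obstructions E u v) = of_bool (blocked E u v b) + of_bool (blocked E u v c)"
    "card (obstructions E v u) = of_bool (blocked E v u y) + of_bool (blocked E v u z)"
    unfolding ou ov by (rule card_filter_pair[OF b(4)], rule card_filter_pair[OF y(4)])
  have excl: "\<not> (blocked E u v c' \<and> blocked E v u y')"
    if "{b, c} = {b', c'}" "{y, z} = {y', z'}" "orient u v c' * orient u v y' < 0" for b' c' y' z'
  proof -
    have "v \<in> interior (convex hull {u, y', z'})" "u \<in> interior (convex hull {v, b', c'})"
      using uI vI that(1,2) by simp_all
    then have "v \<in> interior (convex hull {c', y', z'}) \<or> u \<in> interior (convex hull {y', b', c'})"
      using two_triangles that(3) by blast
    moreover have "insert c' (neighbours E v - {u}) = {c', y', z'}"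
      "insert y' (neighbours E u - {v}) = {y', b', c'}"
      using b y that by auto
    ultimately show ?thesis by (auto simp: blocked_def)
  qed
  have "orient u v b * orient u v c < 0" using opposite_sides[OF uI] .
  moreover have "orient u v y * orient u v z < 0"
    using opposite_sides[OF vI] by (simp add: orient_swap[of v u])
  ultimately consider
      "orient u v c * orient u v y < 0" "orient u v b * orient u v z < 0"
    | "orient u v c * orient u v z < 0" "orient u v b * orient u v y < 0"
    by (auto simp: mult_less_0_iff)
  then show ?thesis
  proof cases
    case 1
    then have "\<not> (blocked E u v c \<and> blocked E v u y)" "\<not> (blocked E u v b \<and> blocked E v u z)"
      using excl[of b c y z] excl[of c b z y] by auto
    then show ?thesis unfolding cards by auto
  next
    case 2
    then have "\<not> (blocked E u v c \<and> blocked E v u z)" "\<not> (blocked E u v b \<and> blocked E v u y)"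
      using excl[of b c z y] excl[of c b y z] by auto
    then show ?thesis unfolding cards by auto
  qed
qed

section \<open>Charges on directed edges\<close>

definition charge :: "point set set \<Rightarrow> point \<Rightarrow> point \<Rightarrow> int" where
  "charge E u v = 2 * of_bool (needed E u v) - 1 - int (card (obstructions E u v))"

text \<open>At the cubic end \<open>u\<close>, two remaining neighbours cannot surround it. At
  \<open>v\<close>, surrounding fails even with the extra neighbour \<open>x\<close>, all the more
  without it.\<close>

lemma obstruction_needed:
  assumes "x \<in> obstructions E u v" "{u, v} \<in> E"
  shows "needed E u v" "needed E v u"
proof -
  have u: "cubic E u" "blocked E u v x" using assms(1) by (auto simp: obstructions_def)
  have "v \<in> neighbours E u" using assms(2) by (simp add: neighbours_def insert_commute)
  then have "card (neighbours E u - {v}) = 2" using u(1) by (simp add: cubic_def)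
  then obtain b c where "neighbours E u - {v} = {b, c}" by (auto simp: card_2_iff)
  then show "needed E u v"
    using u(1) interior_triangle_empty_iff[of b b c] by (simp add: needed_def cubic_def)
  have "interior (convex hull (neighbours E v - {u})) \<subseteq> interior (convex hull (insert x (neighbours E v - {u})))"
    by (intro interior_mono hull_mono) blast
  then show "needed E v u" using u(2) by (auto simp: needed_def blocked_def)
qed

lemma charge_edge:
  assumes E: "convex_graph E" and uv: "{u, v} \<in> E" and "needed E u v \<or> needed E v u"
  shows "charge E u v + charge E v u \<ge> 0"
proof (cases "obstructions E u v = {} \<and> obstructions E v u = {}")
  case True
  then show ?thesis using assms(3) by (auto simp: charge_def)
next
  case False
  have vu: "{v, u} \<in> E" using uv by (simp add: insert_commute)
  have "needed E u v" "needed E v u"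
    using False obstruction_needed[OF _ uv] obstruction_needed[OF _ vu] by blast+
  then show ?thesis using card_obstructions_sum[OF E uv] by (simp add: charge_def)
qed

text \<open>In degree three no target is admissible, so each contributes an obstruction on one of
  the two other edges, at least three in all. From degree four on, \<open>card_needed_le_2\<close>
  suffices.\<close>

lemma charge_vertex:
  assumes D: "convex_decomposition P D" and u: "u \<in> P" "\<not> u extreme_point_of convex hull P"
    and nc: "\<And>v. \<not> contractible_from_to P D u v"
  shows "(\<Sum>v\<in>neighbours (skeleton_edges D) u. charge (skeleton_edges D) u v) \<le> 0"
proof -
  let ?E = "skeleton_edges D" and ?N = "neighbours (skeleton_edges D) u"
  have E: "convex_graph ?E" by (rule convex_graph_skeleton[OF D])
  have N: "?N \<subseteq> P - {u}" by (rule neighbours_subset[OF convex_graphD(1)[OF E]])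
  have fin: "finite ?N" using N finite_P finite_subset by blast
  have sum: "(\<Sum>v\<in>?N. charge ?E u v)
    = 2 * int (card {v \<in> ?N. needed ?E u v}) - int (card ?N) - (\<Sum>v\<in>?N. int (card (obstructions ?E u v)))"
    using fin by (simp add: charge_def sum_subtractf sum.distrib sum_distrib_left[symmetric] Int_def conj_commute)
  obtain a b c where abc: "{a, b, c} \<subseteq> ?N" "u \<in> interior (convex hull {a, b, c})"
    by (rule surrounding_triangle[OF u(1) N convex_graphD(4)[OF E u]])
  have ne: "a \<noteq> b" "a \<noteq> c" "b \<noteq> c" using abc(2) interior_triangle_empty_iff[of a b c] by auto
  have "card ?N \<ge> 3" using card_mono[OF fin abc(1)] ne by simp
  show ?thesis
  proof (cases "card ?N = 3")
    case True
    then have "{a, b, c} = ?N" using card_subset_eq[OF fin abc(1)] ne by simp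
    then have N3: "?N = {a, b, c}" by simp
    have cub: "cubic ?E u" using True u by (simp add: cubic_def)
    have bl: "blocked ?E u x z \<or> blocked ?E u y z" if "?N = {x, y, z}" for x y z
      using contractible_if_not_blocked[OF D u that] nc by blast
    \<comment> \<open>Each neighbour is put last once, in the position of the target.\<close>
    have "?N = {b, c, a}" "?N = {a, c, b}" using N3 by auto
    then have b3: "blocked ?E u a c \<or> blocked ?E u b c" "blocked ?E u b a \<or> blocked ?E u c a"
      "blocked ?E u a b \<or> blocked ?E u c b"
      using bl N3 by blast+
    have ob: "obstructions ?E u a = {x \<in> {b, c}. blocked ?E u a x}"
      "obstructions ?E u b = {x \<in> {a, c}. blocked ?E u b x}"
      "obstructions ?E u c = {x \<in> {a, b}. blocked ?E u c x}"
      using N3 ne cub by (auto simp: obstructions_def)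
    have "(\<Sum>v\<in>?N. int (card (obstructions ?E u v))) = int (card (obstructions ?E u a))
      + int (card (obstructions ?E u b)) + int (card (obstructions ?E u c))"
      unfolding N3 using ne by simp
    also have "\<dots> \<ge> 3"
      unfolding ob card_filter_pair[OF ne(1)] card_filter_pair[OF ne(2)] card_filter_pair[OF ne(3)]
      using b3 by auto
    finally have "(\<Sum>v\<in>?N. int (card (obstructions ?E u v))) \<ge> 3" .
    moreover have "card {v \<in> ?N. needed ?E u v} \<le> 3"
      using card_mono[OF fin, of "{v \<in> ?N. needed ?E u v}"] True by auto
    ultimately show ?thesis unfolding sum using True by linarith
  next
    case False
    then have "card ?N \<ge> 4" using \<open>card ?N \<ge> 3\<close> by linarith
    moreover have "(\<Sum>v\<in>?N. int (card (obstructions ?E u v))) \<ge> 0" by (rule sum_nonneg) simp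
    ultimately show ?thesis using card_needed_le_2[OF E u] unfolding sum by linarith
  qed
qed

text \<open>Provides the strict inequality of the count. If the given edge has only inner ends, the
  rightmost inner vertex has a neighbour farther right, which must be extreme.\<close>

lemma edge_to_extreme_point:
  assumes E: "convex_graph E" and e: "e \<in> E" "e \<notin> polygon_sides (convex hull P)"
  obtains p q where "{p, q} \<in> E" "{p, q} \<notin> polygon_sides (convex hull P)" "p \<in> P"
    "p extreme_point_of convex hull P"
proof (cases "\<exists>p\<in>e. p extreme_point_of convex hull P")
  case True
  then obtain p where p: "p \<in> e" "p extreme_point_of convex hull P" by blast
  obtain a b where "e = {a, b}" by (rule edge_setE[OF convex_graphD(1)[OF E] e(1)])
  then obtain q where "e = {p, q}" using p(1) by blast
  then show thesis using that e p extreme_point_of_convex_hull by blast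
next
  case False
  let ?W = "{v \<in> P. \<not> v extreme_point_of convex hull P}"
  obtain a b where "a \<in> P" "e = {a, b}" by (rule edge_setE[OF convex_graphD(1)[OF E] e(1)])
  then have "?W \<noteq> {}" using False by blast
  moreover have "finite ?W" using finite_P by simp
  ultimately obtain p where p: "p \<in> ?W" "\<forall>x\<in>?W. axis 1 1 \<bullet> x \<le> axis 1 1 \<bullet> p"
    using finite_maximum[of ?W "\<lambda>x. axis 1 1 \<bullet> x"] by auto
  have "p \<in> interior (convex hull (neighbours E p))" using convex_graphD(4)[OF E] p(1) by blast
  moreover have "(axis 1 1 :: point) \<noteq> 0" by (simp add: axis_eq_0_iff)
  ultimately obtain q where q: "q \<in> neighbours E p" "axis 1 1 \<bullet> (q - p) > 0"
    using not_in_interior_convex_hull_iff[of p "neighbours E p"] by (meson not_le)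
  have qP: "q \<in> P" using q(1) neighbours_subset[OF convex_graphD(1)[OF E]] by blast
  have "q \<notin> ?W" using q(2) p(2) by (force simp: inner_diff_right)
  then have "q extreme_point_of convex hull P" using qP by blast
  moreover have "{q, p} \<notin> polygon_sides (convex hull P)" using hull_side_ends(2) p(1) by blast
  ultimately show thesis using that q(1) qP by (auto simp: neighbours_def)
qed

lemma deletable_or_contractible:
  assumes D: "convex_decomposition P D" and card: "card D > 1"
    and nd: "\<And>e. \<not> deletable P D e" and nc: "\<And>u v. \<not> contractible_from_to P D u v"
  shows False
proof -
  let ?E = "skeleton_edges D" and ?S = "polygon_sides (convex hull P)"
  have E: "convex_graph ?E" by (rule convex_graph_skeleton[OF D])
  \<comment> \<open>Hull sides are left out: their charge is \<open>-1\<close> in both directions,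
    which would spoil the lower bound for edges.\<close>
  define M where "M = (\<lambda>u. {v \<in> neighbours ?E u. {u, v} \<notin> ?S})"
  define H where "H = Sigma P M"
  have subP: "M u \<subseteq> P" for u
    using neighbours_subset[OF convex_graphD(1)[OF E]] unfolding M_def by blast
  have finM: "finite (M u)" for u using subP finite_P finite_subset by blast
  have H: "(u, v) \<in> H \<longleftrightarrow> {u, v} \<in> ?E \<and> {u, v} \<notin> ?S" for u v
  proof -
    have "u \<in> P" if "{u, v} \<in> ?E"
      using that neighbours_subset[OF convex_graphD(1)[OF E], of v] by (auto simp: neighbours_def)
    then show ?thesis by (auto simp: H_def M_def neighbours_def insert_commute)
  qed
  let ?T = "\<Sum>(u, v)\<in>H. charge ?E u v"
  \<comment> \<open>Reversal permutes the directed interior edges, so \<open>2 * ?T\<close> is a sum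
    of the nonnegative totals of edges.\<close>
  have "?T = (\<Sum>(u, v)\<in>H. charge ?E v u)"
    by (rule sum.reindex_bij_witness[of _ "\<lambda>(u, v). (v, u)" "\<lambda>(u, v). (v, u)"])
      (auto simp: H insert_commute)
  then have "2 * ?T = (\<Sum>(u, v)\<in>H. charge ?E u v + charge ?E v u)"
    by (simp add: sum.distrib case_prod_beta)
  moreover have "\<dots> \<ge> 0"
  proof (rule sum_nonneg, clarify)
    fix u v assume "(u, v) \<in> H"
    then have uv: "{u, v} \<in> ?E" "interior_edge P D {u, v}" by (auto simp: H interior_edge_def)
    have "needed ?E u v \<or> needed ?E v u" using deletable_if_not_needed[OF D uv(2)] nd by blast
    then show "charge ?E u v + charge ?E v u \<ge> 0" by (rule charge_edge[OF E uv(1)])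
  qed
  ultimately have "?T \<ge> 0" by simp
  moreover have "?T = (\<Sum>u\<in>P. \<Sum>v\<in>M u. charge ?E u v)"
    unfolding H_def by (rule sum.Sigma[symmetric]) (use finite_P finM in auto)
  moreover have "(\<Sum>u\<in>P. \<Sum>v\<in>M u. charge ?E u v) < (\<Sum>u\<in>P. 0)"
  proof (rule sum_strict_mono_ex1[OF finite_P])
    \<comment> \<open>At an extreme point nothing is needed and nothing obstructed, so every
      interior edge costs exactly one.\<close>
    have ext: "(\<Sum>v\<in>M u. charge ?E u v) = - int (card (M u))" if "u extreme_point_of convex hull P" for u
      using that by (simp add: charge_def needed_def obstructions_def cubic_def)
    show "\<forall>u\<in>P. (\<Sum>v\<in>M u. charge ?E u v) \<le> 0"
    proof
      fix u assume u: "u \<in> P"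
      show "(\<Sum>v\<in>M u. charge ?E u v) \<le> 0"
      proof (cases "u extreme_point_of convex hull P")
        case False
        \<comment> \<open>Hull sides end at extreme points, so at an inner vertex no edge was left
          out.\<close>
        then have "M u = neighbours ?E u" using hull_side_ends(1) unfolding M_def by blast
        then show ?thesis using charge_vertex[OF D u False nc] by simp
      qed (simp add: ext)
    qed
    obtain e where "interior_edge P D e" by (rule interior_edge_exists[OF D card])
    then have "e \<in> ?E" "e \<notin> ?S" by (auto simp: interior_edge_def)
    then obtain p q where p: "{p, q} \<in> ?E" "{p, q} \<notin> ?S" "p \<in> P" "p extreme_point_of convex hull P"
      by (rule edge_to_extreme_point[OF E])
    then have "q \<in> M p" by (simp add: M_def neighbours_def insert_commute)
    then have "card (M p) > 0" using finM card_gt_0_iff by blast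
    then show "\<exists>u\<in>P. (\<Sum>v\<in>M u. charge ?E u v) < 0" using ext[OF p(4)] p(3) by (intro bexI[of _ p]) simp_all
  qed
  ultimately show False by simp
qed

end

theorem theorem4:
  fixes P :: "point set" and D :: "point set set"
  assumes "finite P"
    and "card P \<ge> 3"
    and "general_position P"
    and "convex_decomposition P D"
    and "card D > 1"
  shows "(\<exists>e\<in>skeleton_edges D. deletable P D e) \<or> (\<exists>e\<in>skeleton_edges D. contractible_edge P D e)"
proof (rule ccontr)
  interpret points P using assms(1-3) by unfold_locales
  assume *: "\<not> ?thesis"
  have "\<not> deletable P D e" for e
    using * by (auto simp: deletable_def interior_edge_def)
  moreover have "\<not> contractible_from_to P D u v" for u v
    using * by (auto simp: contractible_edge_def contractible_from_to_def interior_edge_def)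
  ultimately show False using deletable_or_contractible[OF assms(4,5)] by blast
qed

end
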